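(* For integers $h\ge2$ and $r\ge1$, there exist quasi-modular forms $f_{s,t}^{(h,r)}$ for $\mathrm{SL}_2(\mathbb{Z})$ of weight $hr-2s-3t$ such that for all $\tau\in\mathbb{H}$ and $z\in\mathbb{C}\setminus L_\tau$ $$\wp_{\{h\}^r}(z;\tau)=\sum_{\substack{s\ge0,\ t\in\{0,1\}\\2s+3t\le h}}f_{s,t}^{(h,r)}(\tau)\,\wp(z;\tau)^s\,(\wp'(z;\tau))^t.$$
   Context: $\mathbb{H}$ is the upper half-plane, $L_\tau=\mathbb{Z}\tau+\mathbb{Z}$, $\mathbb{Z}_N=\{n\in\mathbb{Z}: |n|<N\}$, and $\mathbb{Z}_M\tau+\mathbb{Z}_N=\{m\tau+n: m\in\mathbb{Z}_M, n\in\mathbb{Z}_N\}$. The order $\prec$ on $L_\tau$: $m_1\tau+n_1\prec m_2\tau+n_2$ iff $m_1<m_2$, or $m_1=m_2$ and $n_1<n_2$. For integers $k_1,\dots,k_r\ge2$, $$\wp_{k_1,\dots,k_r}(z;\tau)=\lim_{M\to\infty}\lim_{N\to\infty}\sum_{\substack{w_1,\dots,w_r\in\mathbb{Z}_M\tau+\mathbb{Z}_N\\ w_1\prec\dots\prec w_r}}\frac{1}{(z-w_1)^{k_1}\cdots(z-w_r)^{k_r}}.$$ $\{h\}^r$ is the index $(h,\dots,h)$ with $r$ entries. $\wp(z;\tau)=\frac1{z^2}+\sum_{w\in L_\tau\setminus\{0\}}\left(\frac1{(z-w)^2}-\frac1{w^2}\right)$ is the Weierstrass function and $\wp'$ its derivative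 in $z$. A quasi-modular form of weight $k$ for $\mathrm{SL}_2(\mathbb{Z})$ is a weight-homogeneous polynomial of weight $k$ in the Eisenstein series $G_2,G_4,G_6$ with complex coefficients ($G_j$ of weight $j$; the zero function is allowed in every weight), where $G_k(\tau)=\lim_{M\to\infty}\lim_{N\to\infty}\sum_{(m,n)\in\mathbb{Z}_M\times\mathbb{Z}_N\setminus\{(0,0)\}}(m\tau+n)^{-k}$. *)

theory Defs
  imports "HOL-Complex_Analysis.Complex_Analysis"
begin

definition int_box :: "nat \<Rightarrow> int set" where
  "int_box N = {n. \<bar>n\<bar> < int N}"

definition period_lattice :: "complex \<Rightarrow> complex set" where
  "period_lattice \<tau> = {of_int m * \<tau> + of_int n | m n :: int. True}"

definition lattice_box :: "complex \<Rightarrow> nat \<Rightarrow> nat \<Rightarrow> complex set" where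
  "lattice_box \<tau> M N = {of_int m * \<tau> + of_int n | m n. m \<in> int_box M \<and> n \<in> int_box N}"

text \<open>The coordinates of a lattice point are unique only when \<open>\<tau>\<close> is not real, so this is an
  order on \<open>period_lattice \<tau>\<close> only in that case; see \<open>lattice_less_iff\<close>.\<close>
definition lattice_less :: "complex \<Rightarrow> complex \<Rightarrow> complex \<Rightarrow> bool" where
  "lattice_less \<tau> w w' \<longleftrightarrow> (\<exists>m n m' n' :: int.
     w = of_int m * \<tau> + of_int n \<and> w' = of_int m' * \<tau> + of_int n' \<and>
     (m < m' \<or> m = m' \<and> n < n'))"

definition lattice_chains :: "complex \<Rightarrow> nat \<Rightarrow> nat \<Rightarrow> nat \<Rightarrow> complex list set" where
  "lattice_chains \<tau> r M N =
     {ws. length ws = r \<and> set ws \<subseteq> lattice_box \<tau> M N \<and> sorted_wrt (lattice_less \<tau>) ws}"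

text \<open>The index \<open>(k\<^sub>1, \<dots>, k\<^sub>r)\<close> is the list \<open>ks\<close>.\<close>
definition multiple_wp :: "nat list \<Rightarrow> complex \<Rightarrow> complex \<Rightarrow> complex" where
  "multiple_wp ks z \<tau> =
     lim (\<lambda>M. lim (\<lambda>N. \<Sum>ws\<in>lattice_chains \<tau> (length ks) M N.
       1 / (\<Prod>i<length ks. (z - ws ! i) ^ (ks ! i))))"

definition weierstrass_wp :: "complex \<Rightarrow> complex \<Rightarrow> complex" where
  "weierstrass_wp z \<tau> = 1 / z\<^sup>2 + (\<Sum>\<^sub>\<infinity>w\<in>period_lattice \<tau> - {0}. 1 / (z - w)\<^sup>2 - 1 / w\<^sup>2)"

definition weierstrass_wp' :: "complex \<Rightarrow> complex \<Rightarrow> complex" where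
  "weierstrass_wp' z \<tau> = deriv (\<lambda>u. weierstrass_wp u \<tau>) z"

definition eisenstein_G :: "nat \<Rightarrow> complex \<Rightarrow> complex" where
  "eisenstein_G k \<tau> =
     lim (\<lambda>M. lim (\<lambda>N. \<Sum>(m, n)\<in>int_box M \<times> int_box N - {(0, 0)}.
       1 / (of_int m * \<tau> + of_int n) ^ k))"

text \<open>Quasi-modular forms for \<open>SL\<^sub>2(\<int>)\<close>, as functions on the upper half-plane; values of \<open>f\<close>
  elsewhere are irrelevant.\<close>
definition quasimodular_form :: "nat \<Rightarrow> (complex \<Rightarrow> complex) \<Rightarrow> bool" where
  "quasimodular_form k f \<longleftrightarrow> (\<exists>p :: nat \<Rightarrow> nat \<Rightarrow> nat \<Rightarrow> complex. \<forall>\<tau>. Im \<tau> > 0 \<longrightarrow>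
     f \<tau> = (\<Sum>(a, b, c)\<in>{(a, b, c). 2 * a + 4 * b + 6 * c = k}.
       p a b c * eisenstein_G 2 \<tau> ^ a * eisenstein_G 4 \<tau> ^ b * eisenstein_G 6 \<tau> ^ c))"

text \<open>All the finite sums range over finite sets, so none of them is zero by convention.\<close>

lemma finite_int_box: "finite (int_box N)"
  by (rule finite_subset[of _ "{- int N..int N}"]) (auto simp: int_box_def)

lemma finite_lattice_box: "finite (lattice_box \<tau> M N)"
proof -
  have "lattice_box \<tau> M N =
      (\<lambda>(m, n). of_int m * \<tau> + of_int n) ` (int_box M \<times> int_box N)"
    unfolding lattice_box_def by auto
  then show ?thesis by (simp add: finite_int_box)
qed

lemma finite_lattice_chains: "finite (lattice_chains \<tau> r M N)"
  by (rule finite_subset[OF _ finite_lists_length_eq[OF finite_lattice_box[of \<tau> M N], of r]])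
     (auto simp: lattice_chains_def)

lemma finite_weight_exponents: "finite {(a, b, c). 2 * a + 4 * b + 6 * c = (k :: nat)}"
  by (rule finite_subset[of _ "{..k} \<times> {..k} \<times> {..k}"]) auto

lemma finite_wp_exponents: "finite {(s, t). t \<in> {0, 1} \<and> 2 * s + 3 * t \<le> (h :: nat)}"
  by (rule finite_subset[of _ "{..h} \<times> {..h}"]) auto

lemma lattice_less_iff:
  assumes "Im \<tau> > 0"
  shows "lattice_less \<tau> (of_int m * \<tau> + of_int n) (of_int m' * \<tau> + of_int n') \<longleftrightarrow>
           m < m' \<or> m = m' \<and> n < n'"
proof -
  have "a = c \<and> b = d" if "of_int a * \<tau> + of_int b = of_int c * \<tau> + of_int d" for a b c d :: int
  proof -
    have "a = c" using arg_cong[OF that, of Im] assms by simp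
    then show ?thesis using that by simp
  qed
  then show ?thesis unfolding lattice_less_def by blast
qed

end

theory Submission
  imports Defs
begin

text \<open>Fix \<open>\<tau>\<close> and put \<open>x\<^sub>w = (z - w)\<^sup>-\<^sup>h\<close>. A chain of lattice points is a set of lattice points,
  so \<open>\<wp>\<close> with index \<open>(h, \<dots>, h)\<close> is a limit of the elementary symmetric functions \<open>e\<^sub>r\<close> of the
  numbers \<open>x\<^sub>w\<close>, \<open>w\<close> in a box (\<open>chain_sum_eq_esym\<close>). By Newton's identities \<open>e\<^sub>r\<close> is a polynomial in
  the power sums \<open>\<Sum>\<^sub>w (z - w)\<close> to the power \<open>- h i\<close> (\<open>esym_eq_newton_esym\<close>). These converge to
  \<open>\<wp>\<^sub>k(z) = \<Sum>\<^sub>w (z - w)\<^sup>-\<^sup>k\<close> with \<open>k = h i\<close>, except that for \<open>k = 2\<close> the limit is \<open>\<wp>(z) + G\<^sub>2\<close>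
  (\<open>box_limit_power_sum\<close>).

  Up to a constant factor \<open>\<wp>\<^sub>k\<close> is the derivative of \<open>\<wp>\<close> of order \<open>k - 2\<close>. As
  \<open>\<wp>'' = 6 \<wp>\<^sup>2 - 30 G\<^sub>4\<close>, it is a polynomial in \<open>\<wp>\<close>, \<open>\<wp>'\<close> and \<open>G\<^sub>4\<close>, homogeneous of weight \<open>k\<close> when
  \<open>\<wp>\<close> and \<open>\<wp>'\<close> have weights 2 and 3. Hence the limit of \<open>e\<^sub>r\<close> is homogeneous of weight \<open>h r\<close> in
  \<open>\<wp>\<close>, \<open>\<wp>'\<close>, \<open>G\<^sub>2\<close>, \<open>G\<^sub>4\<close>, \<open>G\<^sub>6\<close> (\<open>wp_form_newton_esym\<close>), and the equation
  \<open>\<wp>'\<^sup>2 = 4 \<wp>\<^sup>3 - 60 G\<^sub>4 \<wp> - 140 G\<^sub>6\<close> removes all powers of \<open>\<wp>'\<close> above the first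
  (\<open>wp_form_normal_form\<close>). Both differential equations come from Liouville's theorem: a doubly
  periodic function without poles is constant (\<open>elliptic_constant\<close>).

  There remains the bound \<open>2 s + 3 t \<le> h\<close>, where weights only give \<open>2 s + 3 t \<le> h r\<close>. It is a bound on
  the pole at the origin. The monomial \<open>\<wp>\<^sup>s \<wp>'\<^sup>t\<close> has a pole of order \<open>2 s + 3 t\<close>, and these orders are
  distinct for \<open>t \<in> {0, 1}\<close>, so poles of different monomials do not cancel
  (\<open>wp_expansion_pole_order\<close>). On the other hand \<open>x\<^sub>0\<close> is the only \<open>x\<^sub>w\<close> with a pole at the origin, the
  pole has order \<open>h\<close>, and \<open>e\<^sub>r\<close> has degree one in \<open>x\<^sub>0\<close> (\<open>pole_order_newton_esym\<close>).\<close>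

section \<open>Elementary symmetric functions and power sums\<close>

definition esym :: "nat \<Rightarrow> ('a \<Rightarrow> complex) \<Rightarrow> 'a set \<Rightarrow> complex" where
  "esym r x A = (\<Sum>X | X \<subseteq> A \<and> card X = r. \<Prod>w\<in>X. x w)"

lemma esym_0: "finite A \<Longrightarrow> esym 0 x A = 1"
proof -
  assume A: "finite A"
  have "{X. X \<subseteq> A \<and> card X = 0} = {{}}"
    using A by (auto dest: finite_subset)
  then show ?thesis
    by (simp add: esym_def)
qed

lemma subsets_containing:
  assumes "finite A" "w \<in> A"
  shows "{X. X \<subseteq> A \<and> card X = Suc r \<and> w \<in> X} = insert w ` {Y. Y \<subseteq> A - {w} \<and> card Y = r}"
    (is "?L = ?R")
proof (intro equalityI subsetI)
  fix X assume X: "X \<in> ?L"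
  then have "finite X" using assms finite_subset by auto
  with X have "X = insert w (X - {w})" "card (X - {w}) = r" "X - {w} \<subseteq> A - {w}"
    by auto
  then show "X \<in> ?R" by blast
next
  fix X assume "X \<in> ?R"
  then obtain Y where Y: "X = insert w Y" "Y \<subseteq> A - {w}" "card Y = r" by blast
  moreover have "finite Y" using Y assms by (meson finite_Diff finite_subset)
  moreover have "w \<notin> Y" using Y by auto
  ultimately show "X \<in> ?L" using assms by auto
qed

lemma sum_subsets_containing:
  fixes x :: "'a \<Rightarrow> complex"
  assumes "finite A" "w \<in> A"
  shows "(\<Sum>X | X \<subseteq> A \<and> card X = Suc r \<and> w \<in> X. \<Prod>v\<in>X. x v) = x w * esym r x (A - {w})"
proof -
  have inj: "inj_on (insert w) {Y. Y \<subseteq> A - {w} \<and> card Y = r}"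
    by (intro inj_onI) blast
  have "(\<Prod>v\<in>insert w Y. x v) = x w * (\<Prod>v\<in>Y. x v)" if "Y \<subseteq> A - {w}" for Y
  proof -
    have "finite Y" using that assms by (meson finite_Diff finite_subset)
    then show ?thesis using that by (subst prod.insert) auto
  qed
  then show ?thesis
    unfolding subsets_containing[OF assms] sum.reindex[OF inj] esym_def sum_distrib_left
    by (intro sum.cong) auto
qed

lemma esym_remove:
  assumes "finite A" "w \<in> A"
  shows "esym (Suc r) x A = esym (Suc r) x (A - {w}) + x w * esym r x (A - {w})"
proof -
  have "{X. X \<subseteq> A \<and> card X = Suc r} =
      {X. X \<subseteq> A - {w} \<and> card X = Suc r} \<union> {X. X \<subseteq> A \<and> card X = Suc r \<and> w \<in> X}"
    by auto
  then have "esym (Suc r) x A = (\<Sum>X \<in> {X. X \<subseteq> A - {w} \<and> card X = Suc r} \<union>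
      {X. X \<subseteq> A \<and> card X = Suc r \<and> w \<in> X}. \<Prod>v\<in>X. x v)"
    by (simp add: esym_def)
  also have "\<dots> = (\<Sum>X | X \<subseteq> A - {w} \<and> card X = Suc r. \<Prod>v\<in>X. x v)
      + (\<Sum>X | X \<subseteq> A \<and> card X = Suc r \<and> w \<in> X. \<Prod>v\<in>X. x v)"
    using assms(1) by (intro sum.union_disjoint) auto
  finally show ?thesis
    using sum_subsets_containing[OF assms, of x r] by (simp add: esym_def)
qed

text \<open>The sum of the monomials \<open>x\<^sub>w\<^sup>i x\<^bsub>w\<^sub>1\<^esub> \<dots> x\<^bsub>w\<^sub>r\<^esub>\<close> with \<open>w\<close> outside the set of the other indices. For
  \<open>i \<ge> 2\<close> this is the monomial symmetric function of the partition \<open>(i, 1, \<dots>, 1)\<close>.\<close>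
definition marked_esym :: "nat \<Rightarrow> nat \<Rightarrow> ('a \<Rightarrow> complex) \<Rightarrow> 'a set \<Rightarrow> complex" where
  "marked_esym r i x A = (\<Sum>w\<in>A. x w ^ i * esym r x (A - {w}))"

text \<open>In the product of \<open>x\<^sub>w\<^sup>i\<close> with a monomial of \<open>e\<^bsub>r+1\<^esub>\<close>, either \<open>w\<close> is a new index, or it occurs already
  and its exponent goes up by one. Newton's identities are the alternating sum of these relations.\<close>
lemma power_sum_times_esym:
  assumes "finite A"
  shows "(\<Sum>w\<in>A. x w ^ i) * esym (Suc r) x A =
    marked_esym (Suc r) i x A + marked_esym r (Suc i) x A"
proof -
  have "x w ^ i * esym (Suc r) x A =
      x w ^ i * esym (Suc r) x (A - {w}) + x w ^ Suc i * esym r x (A - {w})" if "w \<in> A" for w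
    using esym_remove[OF assms that, of r x] by (simp add: algebra_simps)
  then show ?thesis
    by (simp add: marked_esym_def sum_distrib_right sum.distrib)
qed

text \<open>Every set of \<open>r + 1\<close> indices arises once for each choice of its marked element.\<close>
lemma marked_esym_1:
  assumes "finite A"
  shows "marked_esym r 1 x A = of_nat (Suc r) * esym (Suc r) x A"
proof -
  let ?S = "{X. X \<subseteq> A \<and> card X = Suc r}"
  have fin: "finite ?S" using assms by simp
  have "marked_esym r 1 x A = (\<Sum>w\<in>A. \<Sum>X \<in> {X \<in> ?S. w \<in> X}. \<Prod>v\<in>X. x v)"
    unfolding marked_esym_def
    by (intro sum.cong refl) (simp add: sum_subsets_containing[OF assms, symmetric] conj_assoc)
  also have "\<dots> = (\<Sum>X\<in>?S. \<Sum>w \<in> {w \<in> A. w \<in> X}. \<Prod>v\<in>X. x v)"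
    by (rule sum.swap_restrict[OF assms fin])
  also have "\<dots> = (\<Sum>X\<in>?S. of_nat (Suc r) * (\<Prod>v\<in>X. x v))"
  proof (intro sum.cong refl)
    fix X assume X: "X \<in> ?S"
    then have "{w \<in> A. w \<in> X} = X" by auto
    with X show "(\<Sum>w \<in> {w \<in> A. w \<in> X}. \<Prod>v\<in>X. x v) = of_nat (Suc r) * (\<Prod>v\<in>X. x v)"
      by simp
  qed
  finally show ?thesis
    by (simp add: esym_def sum_distrib_left)
qed

text \<open>The relations \<open>power_sum_times_esym\<close> and \<open>marked_esym_1\<close> solved for \<open>marked_esym r i\<close>. The argument
  \<open>p\<close> is an arbitrary sequence because the recursion is applied to limits of power sums as well.\<close>
fun newton :: "(nat \<Rightarrow> complex) \<Rightarrow> nat \<Rightarrow> nat \<Rightarrow> complex" where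
  "newton p 0 i = p i"
| "newton p (Suc r) i = p i * (newton p r 1 / of_nat (Suc r)) - newton p r (Suc i)"

lemma newton_power_sums:
  assumes "finite A"
  shows "newton (\<lambda>i. \<Sum>w\<in>A. x w ^ i) r i = marked_esym r i x A"
proof (induction r arbitrary: i)
  case 0
  then show ?case using assms by (simp add: marked_esym_def esym_0)
next
  case (Suc r)
  show ?case
    using power_sum_times_esym[OF assms, of x i r] marked_esym_1[OF assms, of r x]
    by (simp add: Suc.IH del: One_nat_def of_nat_Suc)
qed

definition newton_esym :: "(nat \<Rightarrow> complex) \<Rightarrow> nat \<Rightarrow> complex" where
  "newton_esym p r = (case r of 0 \<Rightarrow> 1 | Suc r \<Rightarrow> newton p r 1 / of_nat (Suc r))"

lemma esym_eq_newton_esym: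
  assumes "finite A"
  shows "esym r x A = newton_esym (\<lambda>i. \<Sum>w\<in>A. x w ^ i) r"
  using assms
  by (cases r) (simp_all add: newton_esym_def esym_0 newton_power_sums marked_esym_1
      del: One_nat_def of_nat_Suc)

lemma tendsto_newton:
  assumes "\<And>i. i \<ge> 1 \<Longrightarrow> ((\<lambda>n. p n i) \<longlongrightarrow> q i) F" "i \<ge> 1"
  shows "((\<lambda>n. newton (p n) r i) \<longlongrightarrow> newton q r i) F"
  using assms(2)
proof (induction r arbitrary: i)
  case (Suc r)
  show ?case
    unfolding newton.simps
    by (intro tendsto_intros assms(1) Suc.IH Suc.prems) (auto simp del: of_nat_Suc)
qed (use assms in auto)

lemma tendsto_newton_esym:
  assumes "\<And>i. i \<ge> 1 \<Longrightarrow> ((\<lambda>n. p n i) \<longlongrightarrow> q i) F"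
  shows "((\<lambda>n. newton_esym (p n) r) \<longlongrightarrow> newton_esym q r) F"
proof (cases r)
  case (Suc s)
  have "((\<lambda>n. newton (p n) s 1 / of_nat (Suc s)) \<longlongrightarrow> newton q s 1 / of_nat (Suc s)) F"
    by (intro tendsto_intros tendsto_newton assms) (auto simp del: of_nat_Suc)
  then show ?thesis by (simp add: Suc newton_esym_def)
qed (simp add: newton_esym_def)

lemma newton_1: "newton p r 1 = of_nat (Suc r) * newton_esym p (Suc r)"
  by (simp add: newton_esym_def del: of_nat_Suc)

lemma newton_Suc: "newton p (Suc r) i = p i * newton_esym p (Suc r) - newton p r (Suc i)"
  by (simp add: newton_esym_def)

text \<open>Adjoining a variable \<open>c\<close> to a finite set adds \<open>c\<^sup>i\<close> to its power sums and \<open>c e\<^sub>r\<close> to \<open>e\<^bsub>r+1\<^esub>\<close>. An induction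
  along the recursion shows that this holds for every sequence \<open>q\<close>, also for one that does not consist
  of the power sums of a finite set.\<close>
lemma newton_add_power:
  "newton (\<lambda>i. c ^ i + q i) r i =
     newton q r i + c * (case r of 0 \<Rightarrow> 0 | Suc s \<Rightarrow> newton q s i) + c ^ i * newton_esym q r"
  "newton_esym (\<lambda>i. c ^ i + q i) (Suc r) = newton_esym q (Suc r) + c * newton_esym q r"
proof -
  let ?p = "\<lambda>i. c ^ i + q i"
  \<comment> \<open>The marked sum with one index fewer: the new variable \<open>c\<close> takes the place of one of the \<open>r\<close> unmarked indices.\<close>
  let ?prev = "\<lambda>r i. case r of 0 \<Rightarrow> 0 | Suc s \<Rightarrow> newton q s i"
  let ?A = "\<lambda>r i. newton ?p r i = newton q r i + c * ?prev r i + c ^ i * newton_esym q r"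
  have prev_1: "?prev r 1 = of_nat r * newton_esym q r" for r
    by (cases r) (simp_all only: newton_1 nat.case of_nat_0 mult_zero_left)
  have prev_Suc: "newton q r i = q i * newton_esym q r - ?prev r (Suc i)" for r i
    by (cases r) (simp_all add: newton_Suc newton_esym_def del: newton.simps(2))
  have e: "newton_esym ?p (Suc r) = newton_esym q (Suc r) + c * newton_esym q r" if "?A r 1" for r
  proof -
    have "newton ?p r 1 = newton q r 1 + c * (of_nat r * newton_esym q r) + c * newton_esym q r"
      using that by (simp only: prev_1 power_one_right)
    then have "of_nat (Suc r) * newton_esym ?p (Suc r) =
        of_nat (Suc r) * newton_esym q (Suc r) + c * (of_nat r * newton_esym q r) + c * newton_esym q r"
      by (simp only: newton_1)
    also have "\<dots> = of_nat (Suc r) * (newton_esym q (Suc r) + c * newton_esym q r)"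
      by (simp add: algebra_simps)
    finally show ?thesis by (simp only: mult_cancel_left of_nat_eq_0_iff nat.distinct simp_thms)
  qed
  have A: "?A r i" for r i
  proof (induction r arbitrary: i)
    case 0
    show ?case by (simp add: newton_esym_def)
  next
    case (Suc r)
    show ?case
      unfolding newton_Suc e[OF Suc.IH] Suc.IH[of "Suc i"] nat.case prev_Suc[of r i]
      by (simp add: algebra_simps)
  qed
  show "?A r i" "newton_esym ?p (Suc r) = newton_esym q (Suc r) + c * newton_esym q r"
    by (rule A, rule e[OF A])
qed

section \<open>Sums over chains\<close>

lemma lattice_point_inj:
  assumes "Im \<tau> > 0" "of_int a * \<tau> + of_int b = of_int c * \<tau> + of_int d"
  shows "a = c \<and> b = (d :: int)"
proof -
  have "a = c" using arg_cong[OF assms(2), of Im] assms(1) by simp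
  then show ?thesis using assms by simp
qed

text \<open>Within a box the integer \<open>2 N m + n\<close> encodes the lexicographic order of \<open>(m, n)\<close>. Through this
  embedding the theory of sorted lists over a linear order applies to chains.\<close>
lemma box_key_less_iff:
  fixes m n m' n' :: int
  assumes "n \<in> int_box N" "n' \<in> int_box N"
  shows "2 * int N * m + n < 2 * int N * m' + n' \<longleftrightarrow> m < m' \<or> m = m' \<and> n < n'"
proof -
  have *: "2 * int N * m + n < 2 * int N * m' + n'"
    if "m < m'" "n \<in> int_box N" "n' \<in> int_box N" for m n m' n' :: int
  proof -
    have "2 * int N * (m + 1) \<le> 2 * int N * m'"
      using that by (intro mult_left_mono) auto
    then show ?thesis using that by (auto simp: int_box_def algebra_simps)
  qed
  show ?thesis
    using *[of m m' n n'] *[of m' m n' n] assms by (cases m m' rule: linorder_cases) auto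
qed

lemma box_order_embedding:
  assumes "Im \<tau> > 0"
  obtains key :: "complex \<Rightarrow> int" where
    "\<And>w w'. \<lbrakk>w \<in> lattice_box \<tau> M N; w' \<in> lattice_box \<tau> M N\<rbrakk> \<Longrightarrow> lattice_less \<tau> w w' \<longleftrightarrow> key w < key w'"
    "inj_on key (lattice_box \<tau> M N)"
proof -
  define key where "key = (\<lambda>w. THE k. \<exists>m n :: int. w = of_int m * \<tau> + of_int n \<and> k = 2 * int N * m + n)"
  have key: "key (of_int m * \<tau> + of_int n) = 2 * int N * m + n" for m n :: int
    unfolding key_def using lattice_point_inj[OF assms] by (intro the_equality) blast+
  have less: "lattice_less \<tau> w w' \<longleftrightarrow> key w < key w'"
    if "w \<in> lattice_box \<tau> M N" "w' \<in> lattice_box \<tau> M N" for w w'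
    using that by (auto simp: lattice_box_def key lattice_less_iff[OF assms] box_key_less_iff)
  moreover have "inj_on key (lattice_box \<tau> M N)"
  proof (rule inj_onI)
    fix w w' assume w: "w \<in> lattice_box \<tau> M N" "w' \<in> lattice_box \<tau> M N" and eq: "key w = key w'"
    then have "\<not> lattice_less \<tau> w w'" "\<not> lattice_less \<tau> w' w"
      using less by auto
    with w show "w = w'" by (auto simp: lattice_box_def lattice_less_iff[OF assms])
  qed
  ultimately show ?thesis using that by blast
qed

lemma bij_betw_chains_subsets:
  assumes "Im \<tau> > 0"
  shows "bij_betw set (lattice_chains \<tau> r M N) {X. X \<subseteq> lattice_box \<tau> M N \<and> card X = r}"
    and "ws \<in> lattice_chains \<tau> r M N \<Longrightarrow> distinct ws"
proof -
  let ?B = "lattice_box \<tau> M N"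
  obtain key :: "complex \<Rightarrow> int" where
    less: "\<And>w w'. \<lbrakk>w \<in> ?B; w' \<in> ?B\<rbrakk> \<Longrightarrow> lattice_less \<tau> w w' \<longleftrightarrow> key w < key w'"
    and inj: "inj_on key ?B"
    using box_order_embedding[OF assms] by blast
  have sorted_iff: "sorted_wrt (lattice_less \<tau>) ws \<longleftrightarrow> sorted_wrt (<) (map key ws)"
    if "set ws \<subseteq> ?B" for ws
    using that
  proof (induction ws)
    case (Cons w ws)
    have "lattice_less \<tau> w v \<longleftrightarrow> key w < key v" if "v \<in> set ws" for v
      using that Cons.prems by (intro less) auto
    then show ?case using Cons by auto
  qed simp
  have dist: "distinct ws" if "ws \<in> lattice_chains \<tau> r M N" for ws
  proof -
    have "sorted_wrt (<) (map key ws)"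
      using that sorted_iff by (auto simp: lattice_chains_def)
    then have "distinct (map key ws)" by (simp add: strict_sorted_iff)
    then show ?thesis by (simp add: distinct_map)
  qed
  show "ws \<in> lattice_chains \<tau> r M N \<Longrightarrow> distinct ws" by (rule dist)
  show "bij_betw set (lattice_chains \<tau> r M N) {X. X \<subseteq> ?B \<and> card X = r}"
    unfolding bij_betw_def
  proof
    show "inj_on set (lattice_chains \<tau> r M N)"
    proof (rule inj_onI)
      fix ws vs assume ws: "ws \<in> lattice_chains \<tau> r M N" and vs: "vs \<in> lattice_chains \<tau> r M N"
        and eq: "set ws = set vs"
      have "map key ws = map key vs"
        using ws vs eq sorted_iff
        by (intro strict_sorted_equal) (auto simp: lattice_chains_def)
      moreover have "set ws \<union> set vs \<subseteq> ?B"
        using ws vs by (auto simp: lattice_chains_def)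
      ultimately show "ws = vs"
        using inj_on_map_eq_map inj_on_subset[OF inj] by blast
    qed
    show "set ` lattice_chains \<tau> r M N = {X. X \<subseteq> ?B \<and> card X = r}"
    proof (intro equalityI subsetI)
      fix X assume "X \<in> set ` lattice_chains \<tau> r M N"
      then show "X \<in> {X. X \<subseteq> ?B \<and> card X = r}"
        using dist by (auto simp: lattice_chains_def distinct_card)
    next
      fix X assume "X \<in> {X. X \<subseteq> ?B \<and> card X = r}"
      then have X: "X \<subseteq> ?B" "card X = r" by auto
      have fin: "finite X" using X(1) finite_lattice_box finite_subset by blast
      define ks where "ks = sorted_list_of_set (key ` X)"
      define ws where "ws = map (inv_into X key) ks"
      have injX: "inj_on key X" using inj X(1) inj_on_subset by blast
      have ks: "set ks = key ` X" "sorted_wrt (<) ks" "length ks = r"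
        using fin X(2) by (auto simp: ks_def card_image[OF injX])
      have set_ws: "set ws = X"
        by (simp add: ws_def ks(1) image_image inv_into_f_f[OF injX] cong: image_cong)
      have "map key ws = ks"
        using ks(1) by (auto simp: ws_def f_inv_into_f intro!: map_idI)
      then have "ws \<in> lattice_chains \<tau> r M N"
        using set_ws X(1) ks sorted_iff[of ws] by (auto simp: lattice_chains_def ws_def)
      then show "X \<in> set ` lattice_chains \<tau> r M N"
        using set_ws by blast
    qed
  qed
qed

lemma chain_sum_eq_esym:
  assumes "Im \<tau> > 0"
  shows "(\<Sum>ws\<in>lattice_chains \<tau> r M N. 1 / (\<Prod>i<r. (z - ws ! i) ^ h)) =
    esym r (\<lambda>w. 1 / (z - w) ^ h) (lattice_box \<tau> M N)"
proof -
  have "1 / (\<Prod>i<r. (z - ws ! i) ^ h) = (\<Prod>w\<in>set ws. 1 / (z - w) ^ h)"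
    if "ws \<in> lattice_chains \<tau> r M N" for ws
  proof -
    have len: "length ws = r" using that by (simp add: lattice_chains_def)
    have "(\<Prod>w\<in>set ws. 1 / (z - w) ^ h) = (\<Prod>i<r. 1 / (z - ws ! i) ^ h)"
      using bij_betw_nth[OF bij_betw_chains_subsets(2)[OF assms that] refl refl] len
      by (subst prod.reindex_bij_betw[symmetric, where h = "(!) ws" and S = "{..<r}"]) auto
    then show ?thesis by (simp add: prod_dividef)
  qed
  then show ?thesis
    unfolding esym_def
    using sum.reindex_bij_betw[OF bij_betw_chains_subsets(1)[OF assms, of r M N],
        of "\<lambda>X. \<Prod>w\<in>X. 1 / (z - w) ^ h"]
    by simp
qed

section \<open>Iterated limits over boxes\<close>

definition box_limit :: "(nat \<Rightarrow> nat \<Rightarrow> complex) \<Rightarrow> complex \<Rightarrow> bool" where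
  "box_limit a L \<longleftrightarrow> (\<exists>b. (\<forall>M. a M \<longlonglongrightarrow> b M) \<and> b \<longlonglongrightarrow> L)"

lemma lim_lim_eq:
  assumes "box_limit a L"
  shows "lim (\<lambda>M. lim (\<lambda>N. a M N)) = L"
proof -
  obtain b where b: "\<And>M. a M \<longlonglongrightarrow> b M" "b \<longlonglongrightarrow> L"
    using assms by (auto simp: box_limit_def)
  then have "(\<lambda>M. lim (a M)) = b" by (auto intro: limI)
  then show ?thesis using b(2) by (auto intro: limI)
qed

lemma box_limit_add:
  assumes "box_limit a L" "box_limit a' L'"
  shows "box_limit (\<lambda>M N. a M N + a' M N) (L + L')"
proof -
  obtain b b' where "\<And>M. a M \<longlonglongrightarrow> b M" "b \<longlonglongrightarrow> L" "\<And>M. a' M \<longlonglongrightarrow> b' M" "b' \<longlonglongrightarrow> L'"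
    using assms unfolding box_limit_def by blast
  then show ?thesis
    unfolding box_limit_def by (intro exI[of _ "\<lambda>M. b M + b' M"]) (auto intro: tendsto_add)
qed

lemma box_limit_newton_esym:
  assumes "\<And>i. i \<ge> 1 \<Longrightarrow> box_limit (\<lambda>M N. p M N i) (q i)"
  shows "box_limit (\<lambda>M N. newton_esym (p M N) r) (newton_esym q r)"
proof -
  obtain b where "\<And>i M. i \<ge> 1 \<Longrightarrow> (\<lambda>N. p M N i) \<longlonglongrightarrow> b i M" "\<And>i. i \<ge> 1 \<Longrightarrow> b i \<longlonglongrightarrow> q i"
    using assms unfolding box_limit_def by metis
  then show ?thesis
    unfolding box_limit_def
    by (intro exI[of _ "\<lambda>M. newton_esym (\<lambda>i. b i M) r"]) (auto intro: tendsto_newton_esym)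
qed

lemma filterlim_int_box: "filterlim int_box (finite_subsets_at_top UNIV) sequentially"
proof (rule filterlim_finite_subsets_at_top[THEN iffD2], intro allI impI)
  fix X :: "int set" assume X: "finite X \<and> X \<subseteq> UNIV"
  then obtain B where B: "\<forall>x\<in>abs ` X. x \<le> B"
    using bdd_above_finite[of "abs ` X"] by (auto simp: bdd_above_def)
  show "\<forall>\<^sub>F N in sequentially. finite (int_box N) \<and> X \<subseteq> int_box N \<and> int_box N \<subseteq> UNIV"
    using eventually_gt_at_top[of "nat B"]
  proof eventually_elim
    case (elim N)
    have "\<bar>x\<bar> < int N" if "x \<in> X" for x
      using B that elim by force
    then show ?case using finite_int_box by (auto simp: int_box_def)
  qed
qed

lemma has_sum_imp_int_box_limit:
  assumes "(f has_sum S) (UNIV :: int set)"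
  shows "(\<lambda>N. \<Sum>n\<in>int_box N. f n) \<longlonglongrightarrow> S"
  using assms filterlim_compose[OF _ filterlim_int_box] unfolding has_sum_def by fastforce

lemma box_limit_rows:
  assumes "\<And>m. ((\<lambda>n. f m n) has_sum g m) (UNIV :: int set)" "(g has_sum S) (UNIV :: int set)"
  shows "box_limit (\<lambda>M N. \<Sum>m\<in>int_box M. \<Sum>n\<in>int_box N. f m n) S"
  unfolding box_limit_def
  by (intro exI[of _ "\<lambda>M. \<Sum>m\<in>int_box M. g m"])
     (auto intro!: tendsto_sum has_sum_imp_int_box_limit assms)

lemma sum_lattice_box:
  assumes "Im \<tau> > 0"
  shows "(\<Sum>w\<in>lattice_box \<tau> M N. f w) =
    (\<Sum>m\<in>int_box M. \<Sum>n\<in>int_box N. f (of_int m * \<tau> + of_int n))"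
proof -
  let ?w = "\<lambda>(m, n). of_int m * \<tau> + of_int n"
  have eq: "lattice_box \<tau> M N = ?w ` (int_box M \<times> int_box N)"
    unfolding lattice_box_def by auto
  have "inj_on ?w (int_box M \<times> int_box N)"
    using lattice_point_inj[OF assms] by (auto intro!: inj_onI)
  then show ?thesis
    unfolding eq by (simp add: sum.reindex sum.cartesian_product case_prod_unfold)
qed

lemma bij_betw_lattice:
  assumes "Im \<tau> > 0"
  shows "bij_betw (\<lambda>(m, n). of_int m * \<tau> + of_int n) (UNIV \<times> UNIV) (period_lattice \<tau>)"
  unfolding bij_betw_def period_lattice_def
  using lattice_point_inj[OF assms] by (auto intro!: inj_onI)

text \<open>Unconditional convergence permits summation by rows, first over \<open>n\<close> and then over \<open>m\<close>.\<close>
lemma box_limit_infsum: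
  assumes "Im \<tau> > 0" "f summable_on period_lattice \<tau>"
  shows "box_limit (\<lambda>M N. \<Sum>w\<in>lattice_box \<tau> M N. f w) (infsum f (period_lattice \<tau>))"
proof -
  let ?F = "\<lambda>(m, n). f (of_int m * \<tau> + of_int n)"
  have "(f has_sum infsum f (period_lattice \<tau>)) (period_lattice \<tau>)"
    using assms(2) by simp
  then have sum: "(?F has_sum infsum f (period_lattice \<tau>)) (UNIV \<times> UNIV)"
    by (subst (asm) has_sum_reindex_bij_betw[OF bij_betw_lattice[OF assms(1)], symmetric])
       (simp add: case_prod_unfold)
  have row: "((\<lambda>n. ?F (m, n)) has_sum infsum (\<lambda>n. ?F (m, n)) UNIV) UNIV" for m
    using summable_on_SigmaD1[of "\<lambda>m n. ?F (m, n)" UNIV "\<lambda>_. UNIV" m] has_sum_imp_summable[OF sum]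
    by (simp add: has_sum_infsum)
  show ?thesis
    unfolding sum_lattice_box[OF assms(1)]
    by (rule box_limit_rows[OF row[simplified] has_sum_SigmaD[OF sum row, simplified]])
qed

section \<open>Lattice sums\<close>

lemma summable_on_int_powr: "(\<lambda>n::int. (1 + \<bar>of_int n\<bar>) powr - (3 / 2) :: real) summable_on UNIV"
proof -
  let ?f = "\<lambda>n::int. (1 + \<bar>of_int n\<bar>) powr - (3 / 2) :: real"
  have "summable (\<lambda>n. of_nat (Suc n) powr - (3 / 2) :: real)"
    by (subst summable_Suc_iff) (simp add: summable_real_powr_iff)
  then have nat: "(\<lambda>n. of_nat (Suc n) powr - (3 / 2) :: real) summable_on UNIV"
    by (intro summable_nonneg_imp_summable_on) auto
  have "?f summable_on range int" "?f summable_on range (\<lambda>n. - int n)"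
    using nat by (subst summable_on_reindex; simp add: o_def inj_def)+
  then have "?f summable_on (range int \<union> range (\<lambda>n. - int n))"
    by (rule summable_on_union)
  moreover have "range int \<union> range (\<lambda>n. - int n) = UNIV"
    by (auto intro: int_cases2)
  ultimately show ?thesis by simp
qed

locale lattice =
  fixes \<tau> :: complex
  assumes Im_pos: "Im \<tau> > 0"
begin

abbreviation L :: "complex set" where "L \<equiv> period_lattice \<tau>"

lemma lattice_pointI [intro, simp]: "of_int m * \<tau> + of_int n \<in> L"
  by (auto simp: period_lattice_def)

lemma zero_in_L [simp]: "0 \<in> L"
  using lattice_pointI[of 0 0] by simp

lemma one_in_L: "1 \<in> L"
  using lattice_pointI[of 0 1] by simp

lemma tau_in_L: "\<tau> \<in> L"
  using lattice_pointI[of 1 0] by simp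

lemma add_in_L: "w \<in> L \<Longrightarrow> v \<in> L \<Longrightarrow> w + v \<in> L"
proof -
  assume "w \<in> L" "v \<in> L"
  then obtain m n m' n' :: int where "w = of_int m * \<tau> + of_int n" "v = of_int m' * \<tau> + of_int n'"
    by (auto simp: period_lattice_def)
  then have "w + v = of_int (m + m') * \<tau> + of_int (n + n')" by (simp add: algebra_simps)
  then show ?thesis by (simp only: lattice_pointI)
qed

lemma uminus_in_L: "w \<in> L \<Longrightarrow> - w \<in> L"
proof -
  assume "w \<in> L"
  then obtain m n :: int where "w = of_int m * \<tau> + of_int n"
    by (auto simp: period_lattice_def)
  then have "- w = of_int (- m) * \<tau> + of_int (- n)" by (simp add: algebra_simps)
  then show ?thesis by (simp only: lattice_pointI)
qed

lemma diff_in_L: "w \<in> L \<Longrightarrow> v \<in> L \<Longrightarrow> w - v \<in> L"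
  using add_in_L[of w "- v"] uminus_in_L[of v] by simp

lemma countable_L: "countable L"
proof -
  have "L = (\<lambda>(m, n). of_int m * \<tau> + of_int n) ` UNIV"
    by (auto simp: period_lattice_def)
  then show ?thesis by (metis countable_image countableI_type)
qed

text \<open>The imaginary part of \<open>m \<tau> + n\<close> controls \<open>m\<close>, and then \<open>n = (m \<tau> + n) - m \<tau>\<close> is controlled too.\<close>
lemma coordinate_bound:
  obtains K where "K > 0" "\<And>m n :: int. \<bar>of_int m\<bar> + \<bar>of_int n\<bar> \<le> K * norm (of_int m * \<tau> + of_int n)"
proof
  let ?K = "1 / Im \<tau> + 1 + norm \<tau> / Im \<tau>"
  show "?K > 0" using Im_pos by (simp add: add_pos_nonneg)
  fix m n :: int
  let ?w = "of_int m * \<tau> + of_int n"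
  have "\<bar>Im ?w\<bar> \<le> norm ?w" by (rule abs_Im_le_cmod)
  then have m: "\<bar>of_int m\<bar> \<le> norm ?w / Im \<tau>"
    using Im_pos by (simp add: abs_mult field_simps)
  have "\<bar>of_int n\<bar> = norm (?w - of_int m * \<tau>)" by simp
  also have "\<dots> \<le> norm ?w + norm (of_int m * \<tau>)" by (rule norm_triangle_ineq4)
  also have "\<dots> \<le> norm ?w + norm ?w / Im \<tau> * norm \<tau>"
    using mult_right_mono[OF m, of "norm \<tau>"] by (simp add: norm_mult)
  finally have "\<bar>of_int n\<bar> \<le> norm ?w + norm ?w / Im \<tau> * norm \<tau>" .
  moreover have "?K * norm ?w = norm ?w / Im \<tau> + (norm ?w + norm ?w / Im \<tau> * norm \<tau>)"
    by (simp add: algebra_simps)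
  ultimately show "\<bar>of_int m\<bar> + \<bar>of_int n\<bar> \<le> ?K * norm ?w"
    using m by linarith
qed

lemma norm_lattice_ge:
  obtains d where "d > 0" "\<And>w. w \<in> L - {0} \<Longrightarrow> norm w \<ge> d"
proof -
  obtain K where K: "K > 0"
    "\<And>m n :: int. \<bar>of_int m\<bar> + \<bar>of_int n\<bar> \<le> K * norm (of_int m * \<tau> + of_int n)"
    using coordinate_bound by blast
  have "norm w \<ge> 1 / K" if wL: "w \<in> L - {0}" for w
  proof -
    obtain m n :: int where w: "w = of_int m * \<tau> + of_int n"
      using wL by (auto simp: period_lattice_def)
    then have "m \<noteq> 0 \<or> n \<noteq> 0" using wL by auto
    then have "1 \<le> \<bar>real_of_int m\<bar> + \<bar>real_of_int n\<bar>" by linarith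
    also have "\<dots> \<le> K * norm w" unfolding w by (rule K)
    finally show ?thesis using K(1) by (simp add: field_simps)
  qed
  with K(1) that[of "1 / K"] show ?thesis by simp
qed

text \<open>The distance between distinct lattice points is bounded below, since differences of lattice points
  are lattice points.\<close>
lemma closed_sublattice_set: "S \<subseteq> L \<Longrightarrow> closed S"
proof -
  assume S: "S \<subseteq> L"
  obtain d where d: "d > 0" "\<And>w. w \<in> L - {0} \<Longrightarrow> norm w \<ge> d"
    using norm_lattice_ge by blast
  show ?thesis
  proof (rule discrete_imp_closed[OF d(1)], intro ballI impI)
    fix x y assume "x \<in> S" "y \<in> S" "dist y x < d"
    then show "y = x" using d(2)[of "y - x"] diff_in_L[of y x] S by (auto simp: dist_norm)
  qed
qed

text \<open>From \<open>(1 + \<bar>m\<bar>) (1 + \<bar>n\<bar>) \<le> (2 (\<bar>m\<bar> + \<bar>n\<bar>))\<^sup>2\<close> the term at \<open>w = m \<tau> + n\<close> is at most a constant times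
  \<open>((1 + \<bar>m\<bar>) (1 + \<bar>n\<bar>))\<close> to the power \<open>- 3/2\<close>, and the double series of these splits into a product of
  two convergent series.\<close>
lemma summable_cube: "(\<lambda>w. 1 / norm w ^ 3) summable_on L"
proof -
  obtain K where K: "K > 0"
    "\<And>m n :: int. \<bar>of_int m\<bar> + \<bar>of_int n\<bar> \<le> K * norm (of_int m * \<tau> + of_int n)"
    using coordinate_bound by blast
  let ?a = "\<lambda>n::int. (1 + \<bar>of_int n\<bar>) powr - (3 / 2) :: real"
  have "(\<lambda>(m, n). ?a m * ?a n) summable_on (UNIV \<times> UNIV)"
    using summable_on_int_powr
    by (intro summable_on_SigmaI[where g = "\<lambda>m. ?a m * infsum ?a UNIV"])
       (auto intro!: has_sum_cmult_right summable_on_cmult_left)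
  then have sum: "(\<lambda>(m, n). (2 * K) ^ 3 * (?a m * ?a n)) summable_on (UNIV \<times> UNIV)"
    using summable_on_cmult_right[of _ _ "(2 * K) ^ 3"] by (simp add: case_prod_unfold)
  have bound: "1 / norm (of_int m * \<tau> + of_int n) ^ 3 \<le> (2 * K) ^ 3 * (?a m * ?a n)" for m n :: int
  proof (cases "m = 0 \<and> n = 0")
    case False
    define s where "s = \<bar>real_of_int m\<bar> + \<bar>real_of_int n\<bar>"
    define q where "q = (1 + \<bar>real_of_int m\<bar>) * (1 + \<bar>real_of_int n\<bar>)"
    have s1: "s \<ge> 1" using False unfolding s_def by linarith
    have q0: "q > 0" unfolding q_def by (intro mult_pos_pos) auto
    have "q \<le> (2 * s) ^ 2"
    proof -
      have "1 + \<bar>real_of_int m\<bar> \<le> 2 * s" "1 + \<bar>real_of_int n\<bar> \<le> 2 * s"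
        using s1 unfolding s_def by argo+
      then show ?thesis unfolding q_def power2_eq_square by (intro mult_mono) (use s1 in auto)
    qed
    then have "q powr (3 / 2) \<le> ((2 * s) ^ 2) powr (3 / 2)"
      using q0 by (intro powr_mono2) auto
    also have "\<dots> = (2 * s) ^ 3"
      using powr_powr[of "2 * s" 2 "3 / 2"] s1 by (simp only: powr_numeral) simp
    also have "\<dots> \<le> (2 * K * norm (of_int m * \<tau> + of_int n)) ^ 3"
      using K(2)[of m n] s1 by (intro power_mono) (auto simp: s_def mult.assoc)
    finally have le: "q powr (3 / 2) \<le> (2 * K) ^ 3 * norm (of_int m * \<tau> + of_int n) ^ 3"
      by (simp add: power_mult_distrib)
    have a: "?a m * ?a n = 1 / q powr (3 / 2)"
      using powr_mult[of "1 + \<bar>real_of_int m\<bar>" "1 + \<bar>real_of_int n\<bar>" "- (3 / 2)"]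
        powr_minus_divide[of q "3 / 2"] unfolding q_def by argo
    have pos: "0 < norm (of_int m * \<tau> + of_int n)"
      using K(2)[of m n] s1 K(1) unfolding s_def
      by (metis linorder_not_le mult_eq_0_iff norm_le_zero_iff norm_zero not_one_le_zero order_trans)
    have frac: "1 / N \<le> D * (1 / Q)" if "Q \<le> D * N" "0 < N" "0 < Q" for N D Q :: real
      using that by (simp add: field_simps)
    show ?thesis
      unfolding a by (rule frac[OF le]) (use pos q0 in auto)
  qed (use K in auto)
  have "(\<lambda>(m, n). 1 / norm (of_int m * \<tau> + of_int n) ^ 3) summable_on (UNIV \<times> UNIV)"
    using sum by (rule summable_on_comparison_test) (use bound in auto)
  then show ?thesis
    by (subst summable_on_reindex_bij_betw[OF bij_betw_lattice[OF Im_pos], symmetric])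
       (simp add: case_prod_unfold)
qed

lemma summable_by_cube:
  fixes f :: "complex \<Rightarrow> complex"
  assumes "\<And>w. w \<in> L - {0} \<Longrightarrow> norm (f w) \<le> B / norm w ^ 3"
  shows "f summable_on L - {0}"
proof -
  have "(\<lambda>w. 1 / norm w ^ 3) summable_on L - {0}"
    using summable_cube by (rule summable_on_subset) auto
  then have "(\<lambda>w. B * (1 / norm w ^ 3)) summable_on L - {0}"
    by (rule summable_on_cmult_right)
  then show ?thesis
    using Infinite_Sum.abs_summable_on_comparison_test'[of "\<lambda>w. B * (1 / norm w ^ 3)" "L - {0}" f] assms
    by (intro abs_summable_summable[of f]) simp
qed

text \<open>For \<open>w\<close> far away this is the triangle inequality; the remaining \<open>w\<close> have bounded norm, and their
  distance to a small disc around \<open>z0\<close> is positive. The point is that \<open>c\<close> does not depend on \<open>z\<close>, which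
  gives locally uniform convergence of lattice sums.\<close>
lemma distance_to_lattice:
  assumes "z0 \<notin> L - {0}"
  obtains e c where "e > 0" "c > 0"
    "\<And>z w. z \<in> cball z0 e \<Longrightarrow> w \<in> L - {0} \<Longrightarrow> c * norm w \<le> norm (z - w)"
proof -
  have "open (- (L - {0}))" by (intro open_Compl closed_sublattice_set) auto
  then obtain e' where e': "e' > 0" "ball z0 e' \<subseteq> - (L - {0})"
    using assms by (meson ComplI open_contains_ball)
  \<comment> \<open>Halving the radius leaves distance \<open>e\<close> between the small disc and the nonzero lattice points.\<close>
  define e where "e = e' / 2"
  have e: "e > 0" using e' by (simp add: e_def)
  define R where "R = norm z0 + e"
  have R: "R > 0" using e by (simp add: R_def add_nonneg_pos)
  define c where "c = min (1 / 2) (e / (2 * R))"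
  have "c * norm w \<le> norm (z - w)" if z: "z \<in> cball z0 e" and w: "w \<in> L - {0}" for z w
  proof (cases "norm w \<le> 2 * R")
    case True
    have "w \<notin> ball z0 e'" using e' w by blast
    then have "2 * e \<le> norm (z0 - w)" by (simp add: dist_norm e_def)
    also have "\<dots> \<le> norm (z0 - z) + norm (z - w)" using norm_triangle_ineq[of "z0 - z" "z - w"] by simp
    finally have "e \<le> norm (z - w)" using z by (simp add: dist_norm)
    moreover have "c * norm w \<le> e / (2 * R) * (2 * R)"
      using True R e by (intro mult_mono) (auto simp: c_def)
    ultimately show ?thesis using R by simp
  next
    case False
    have "norm z \<le> R"
      using z norm_triangle_ineq[of z0 "z - z0"] by (simp add: R_def dist_norm norm_minus_commute)
    moreover have "norm w - norm z \<le> norm (z - w)"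
      using norm_triangle_ineq2[of w z] by (simp add: norm_minus_commute)
    moreover have "c * norm w \<le> 1 / 2 * norm w" by (intro mult_right_mono) (auto simp: c_def)
    ultimately show ?thesis using False by linarith
  qed
  moreover have "c > 0" using e R by (simp add: c_def)
  ultimately show ?thesis using that e by blast
qed

text \<open>The series of \<open>(z - w)\<^sup>-\<^sup>2\<close> converges absolutely only after subtracting \<open>w\<^sup>-\<^sup>2\<close>. At \<open>w = 0\<close> the
  subtracted term is \<open>1 / 0 = 0\<close>, so that \<open>regular_term 2 z 0\<close> is the term \<open>z\<^sup>-\<^sup>2\<close> of \<open>\<wp>\<close>.\<close>
definition regular_term :: "nat \<Rightarrow> complex \<Rightarrow> complex \<Rightarrow> complex" where
  "regular_term k z w = 1 / (z - w) ^ k - (if k = 2 then 1 / w ^ 2 else 0)"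

definition regular_part :: "nat \<Rightarrow> complex \<Rightarrow> complex" where
  "regular_part k z = (\<Sum>\<^sub>\<infinity>w\<in>L - {0}. regular_term k z w)"

text \<open>For \<open>k \<ge> 3\<close> this is \<open>distance_to_lattice\<close>. For \<open>k = 2\<close> the difference of the two fractions has the
  numerator \<open>z (2 w - z)\<close>, which grows only linearly in \<open>w\<close>, over a denominator of degree 4.\<close>
lemma regular_term_bound:
  assumes "k \<ge> 2" "z0 \<notin> L - {0}"
  obtains e B where "e > 0" "cball z0 e \<subseteq> - (L - {0})"
    "\<And>z w. z \<in> cball z0 e \<Longrightarrow> w \<in> L - {0} \<Longrightarrow> norm (regular_term k z w) \<le> B / norm w ^ 3"
proof -
  obtain e c where ec: "e > 0" "c > 0"
    and dist: "\<And>z w. z \<in> cball z0 e \<Longrightarrow> w \<in> L - {0} \<Longrightarrow> c * norm w \<le> norm (z - w)"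
    using distance_to_lattice[OF assms(2)] by blast
  obtain d where d: "d > 0" "\<And>w. w \<in> L - {0} \<Longrightarrow> norm w \<ge> d"
    using norm_lattice_ge by blast
  define R where "R = norm z0 + e"
  have R: "R > 0" using ec by (simp add: R_def add_nonneg_pos)
  have sub: "cball z0 e \<subseteq> - (L - {0})"
  proof
    fix z assume z: "z \<in> cball z0 e"
    show "z \<in> - (L - {0})"
      using dist[OF z, of z] ec by (auto simp: mult_le_0_iff)
  qed
  show ?thesis
  proof (cases "k = 2")
    case True
    have "norm (regular_term k z w) \<le> R * (2 + R / d) / c ^ 2 / norm w ^ 3"
      if z: "z \<in> cball z0 e" and w: "w \<in> L - {0}" for z w
    proof -
      have zR: "norm z \<le> R"
        using z norm_triangle_ineq[of z0 "z - z0"] by (simp add: R_def dist_norm norm_minus_commute)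
      have w0: "norm w > 0" using w by auto
      have zw: "z \<noteq> w" using sub z w by blast
      have "R \<le> R / d * norm w" using d(2)[OF w] d(1) R by (simp add: field_simps)
      moreover have "norm (2 * w - z) \<le> 2 * norm w + R"
        using norm_triangle_ineq4[of "2 * w" z] zR by (simp add: norm_mult)
      ultimately have num: "norm (2 * w - z) \<le> (2 + R / d) * norm w" by (simp add: algebra_simps)
      have "regular_term k z w = (w ^ 2 - (z - w) ^ 2) / (w ^ 2 * (z - w) ^ 2)"
        using True w zw by (simp add: regular_term_def diff_frac_eq)
      also have "w ^ 2 - (z - w) ^ 2 = z * (2 * w - z)"
        by (simp add: power2_eq_square algebra_simps)
      finally have "regular_term k z w = z * (2 * w - z) / (w ^ 2 * (z - w) ^ 2)" .
      then have "norm (regular_term k z w) = norm z * norm (2 * w - z) / (norm w ^ 2 * norm (z - w) ^ 2)"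
        by (simp add: norm_divide norm_mult norm_power)
      also have "\<dots> \<le> R * ((2 + R / d) * norm w) / (norm w ^ 2 * (c * norm w) ^ 2)"
        using dist[OF z w] num zR R d ec w0
        by (intro frac_le mult_mono power_mono mult_pos_pos zero_less_power) auto
      also have "\<dots> = R * (2 + R / d) / c ^ 2 / norm w ^ 3"
        using w0 ec by (simp add: field_simps power2_eq_square power3_eq_cube)
      finally show ?thesis .
    qed
    then show ?thesis using that ec(1) sub by blast
  next
    case False
    then obtain j where j: "k = 3 + j" using assms(1) le_Suc_ex[of 3 k] by auto
    have "norm (regular_term k z w) \<le> 1 / (c ^ k * d ^ j) / norm w ^ 3"
      if z: "z \<in> cball z0 e" and w: "w \<in> L - {0}" for z w
    proof -
      have w0: "norm w > 0" using w by auto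
      have "norm (regular_term k z w) = 1 / norm (z - w) ^ k"
        using False by (simp add: regular_term_def norm_divide norm_power)
      also have "\<dots> \<le> 1 / (c * norm w) ^ k"
        using dist[OF z w] ec w0 by (intro divide_left_mono power_mono mult_pos_pos) (auto simp: intro!: zero_less_power less_le_trans[OF _ dist[OF z w]] )
      also have "\<dots> = 1 / (c ^ k * norm w ^ j * norm w ^ 3)"
        by (simp add: power_mult_distrib j power_add mult_ac)
      also have "\<dots> \<le> 1 / (c ^ k * d ^ j * norm w ^ 3)"
        using d(2)[OF w] d(1) ec w0
        by (intro divide_left_mono mult_right_mono mult_left_mono power_mono mult_pos_pos) auto
      finally show ?thesis by simp
    qed
    then show ?thesis using that ec(1) sub by blast
  qed
qed

lemma regular_term_has_sum:
  assumes "k \<ge> 2" "z \<notin> L - {0}"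
  shows "(regular_term k z has_sum regular_part k z) (L - {0})"
proof -
  obtain e B where e: "e > 0" and "cball z e \<subseteq> - (L - {0})"
    and bound: "\<And>x w. x \<in> cball z e \<Longrightarrow> w \<in> L - {0} \<Longrightarrow> norm (regular_term k x w) \<le> B / norm w ^ 3"
    using regular_term_bound[OF assms] by blast
  have "norm (regular_term k z w) \<le> B / norm w ^ 3" if "w \<in> L - {0}" for w
    by (rule bound) (use e that in simp_all)
  then show ?thesis
    unfolding regular_part_def by (rule has_sum_infsum[OF summable_by_cube])
qed

text \<open>Weierstrass' theorem: the series converges uniformly near \<open>z\<close> by \<open>regular_term_bound\<close>, so it may be
  differentiated term by term.\<close>
lemma regular_part_deriv:
  assumes k: "k \<ge> 2" and z: "z \<notin> L - {0}"
  shows "(regular_part k has_field_derivative - of_nat k * regular_part (Suc k) z) (at z)"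
proof -
  obtain e B where e: "e > 0" and sub: "cball z e \<subseteq> - (L - {0})"
    and bound: "\<And>x w. x \<in> cball z e \<Longrightarrow> w \<in> L - {0} \<Longrightarrow> norm (regular_term k x w) \<le> B / norm w ^ 3"
    using regular_term_bound[OF assms] by blast
  have D: "((\<lambda>x. regular_term k x w) has_field_derivative - of_nat k * regular_term (Suc k) x w) (at x)"
    if "x \<noteq> w" for x w
  proof -
    obtain j where j: "k = Suc j" using k by (cases k) auto
    have base: "((\<lambda>x. inverse (x - w)) has_field_derivative - (inverse (x - w) * 1 * inverse (x - w))) (at x)"
      using that by (intro DERIV_inverse') (auto intro!: derivative_eq_intros)
    have "((\<lambda>x. inverse (x - w) ^ k - (if k = 2 then 1 / w ^ 2 else 0)) has_field_derivative
        (1 + of_nat j) * (- (inverse (x - w) * 1 * inverse (x - w)) * inverse (x - w) ^ j) - 0) (at x)"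
      unfolding j by (intro DERIV_diff DERIV_power_Suc[OF base] DERIV_const)
    moreover have "(\<lambda>x. regular_term k x w) = (\<lambda>x. inverse (x - w) ^ k - (if k = 2 then 1 / w ^ 2 else 0))"
      by (auto simp: regular_term_def divide_inverse power_inverse)
    moreover have "(1 + of_nat j) * (- (inverse (x - w) * 1 * inverse (x - w)) * inverse (x - w) ^ j) - 0
        = - of_nat k * regular_term (Suc k) x w"
    proof -
      have rt: "regular_term (Suc (Suc j)) x w = inverse (x - w) ^ Suc (Suc j)"
        using k by (simp add: regular_term_def j divide_inverse power_inverse)
      show ?thesis unfolding j rt of_nat_Suc power_Suc by algebra
    qed
    ultimately show ?thesis by simp
  qed
  have "(\<lambda>w. 1 / norm w ^ 3) summable_on L - {0}"
    using summable_cube by (rule summable_on_subset) auto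
  then have "(\<lambda>w. B * (1 / norm w ^ 3)) summable_on L - {0}"
    by (rule summable_on_cmult_right)
  then have ul: "uniform_limit (cball z e) (\<lambda>X x. \<Sum>w\<in>X. regular_term k x w) (regular_part k)
      (finite_subsets_at_top (L - {0}))"
    unfolding regular_part_def
    by (intro Weierstrass_m_test_general[where M = "\<lambda>w. B * (1 / norm w ^ 3)"]) (simp_all add: bound del: mem_cball)
  have ev: "\<forall>\<^sub>F X in finite_subsets_at_top (L - {0}).
      continuous_on (cball z e) (\<lambda>x. \<Sum>w\<in>X. regular_term k x w) \<and>
      (\<forall>x\<in>ball z e. ((\<lambda>x. \<Sum>w\<in>X. regular_term k x w) has_field_derivative
         (\<Sum>w\<in>X. - of_nat k * regular_term (Suc k) x w)) (at x))"
  proof (rule eventually_finite_subsets_at_top_weakI)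
    fix X assume X: "finite X" "X \<subseteq> L - {0}"
    have DX: "((\<lambda>x. \<Sum>w\<in>X. regular_term k x w) has_field_derivative
         (\<Sum>w\<in>X. - of_nat k * regular_term (Suc k) x w)) (at x)" if "x \<in> cball z e" for x
      using that sub X by (intro DERIV_sum D) auto
    then have "continuous_on (cball z e) (\<lambda>x. \<Sum>w\<in>X. regular_term k x w)"
      by (rule continuous_at_imp_continuous_on[OF ballI, OF DERIV_isCont])
    with DX show "continuous_on (cball z e) (\<lambda>x. \<Sum>w\<in>X. regular_term k x w) \<and>
      (\<forall>x\<in>ball z e. ((\<lambda>x. \<Sum>w\<in>X. regular_term k x w) has_field_derivative
         (\<Sum>w\<in>X. - of_nat k * regular_term (Suc k) x w)) (at x))"
      by simp
  qed
  obtain g' where g': "\<And>x. x \<in> ball z e \<Longrightarrow> (regular_part k has_field_derivative g' x) (at x) \<and>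
      ((\<lambda>X. \<Sum>w\<in>X. - of_nat k * regular_term (Suc k) x w) \<longlongrightarrow> g' x) (finite_subsets_at_top (L - {0}))"
    using has_complex_derivative_uniform_limit[OF ev ul _ e] by (metis finite_subsets_at_top_neq_bot)
  have S: "((\<lambda>w. - of_nat k * regular_term (Suc k) z w) has_sum - of_nat k * regular_part (Suc k) z) (L - {0})"
    using k z by (intro has_sum_cmult_right regular_term_has_sum) auto
  have "g' z = - of_nat k * regular_part (Suc k) z"
    using e by (intro tendsto_unique[OF finite_subsets_at_top_neq_bot conjunct2[OF g'] S[unfolded has_sum_def]]) simp
  then show ?thesis using g'[of z] e by auto
qed

text \<open>The function \<open>\<wp>\<^sub>k\<close>, split into its principal part at the origin and the rest; \<open>\<wp>\<^sub>2 = \<wp>\<close> and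
  \<open>\<wp>\<^sub>3 = - \<wp>' / 2\<close>.\<close>
definition wpk :: "nat \<Rightarrow> complex \<Rightarrow> complex" where
  "wpk k z = 1 / z ^ k + regular_part k z"

lemma wpk_deriv:
  assumes "k \<ge> 2" "z \<notin> L"
  shows "(wpk k has_field_derivative - of_nat k * wpk (Suc k) z) (at z)"
proof -
  have z0: "z \<noteq> 0" using assms by auto
  obtain j where j: "k = Suc j" using assms by (cases k) auto
  have base: "(inverse has_field_derivative - (inverse z * 1 * inverse z)) (at z)"
    using z0 by (intro DERIV_inverse') (auto intro!: derivative_eq_intros)
  have "((\<lambda>z. inverse z ^ k + regular_part k z) has_field_derivative
        (1 + of_nat j) * (- (inverse z * 1 * inverse z) * inverse z ^ j) +
        - of_nat k * regular_part (Suc k) z) (at z)"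
    unfolding j by (rule DERIV_add[OF DERIV_power_Suc[OF base]]) (use regular_part_deriv[of k z] assms j in auto)
  moreover have "wpk k = (\<lambda>z. inverse z ^ k + regular_part k z)"
    by (auto simp: wpk_def divide_inverse power_inverse)
  moreover have "(1 + of_nat j) * (- (inverse z * 1 * inverse z) * inverse z ^ j) +
        - of_nat k * regular_part (Suc k) z = - of_nat k * wpk (Suc k) z"
    by (simp add: wpk_def j divide_inverse power_inverse algebra_simps)
  ultimately show ?thesis by simp
qed

lemma open_compl_L: "open (- L)"
  by (intro open_Compl closed_sublattice_set) auto

lemma wpk_has_sum:
  assumes "k \<ge> 2" "z \<notin> L"
  shows "(regular_term k z has_sum wpk k z) L"
proof -
  have "insert 0 (L - {0}) = L" "regular_term k z 0 = 1 / z ^ k"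
    by (auto simp: regular_term_def)
  then show ?thesis
    using has_sum_insert[OF _ regular_term_has_sum[of k z], of 0] assms
    by (simp add: wpk_def)
qed

lemma wp_eq: "z \<notin> L \<Longrightarrow> weierstrass_wp z \<tau> = wpk 2 z"
  by (simp add: weierstrass_wp_def wpk_def regular_part_def regular_term_def)

lemma wp'_eq:
  assumes "z \<notin> L"
  shows "weierstrass_wp' z \<tau> = - 2 * wpk 3 z"
proof -
  have "((\<lambda>u. weierstrass_wp u \<tau>) has_field_derivative - 2 * wpk 3 z) (at z)"
    by (rule has_field_derivative_transform_within_open[OF _ open_compl_L])
       (use wpk_deriv[of 2 z] assms wp_eq in \<open>auto simp: eval_nat_numeral\<close>)
  then show ?thesis unfolding weierstrass_wp'_def by (rule DERIV_imp_deriv)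
qed

lemma uminus_lattice_bij: "bij_betw uminus (L - {0}) (L - {0})"
  by (rule bij_betwI[where g = uminus]) (auto intro: uminus_in_L)

lemma regular_part_uminus: "regular_part k (- z) = (- 1) ^ k * regular_part k z"
proof -
  have "regular_term k (- z) (- w) = (- 1) ^ k * regular_term k z w" for w
  proof -
    have pow: "(- z - - w) ^ k = (- 1) ^ k * (z - w) ^ k"
      by (simp flip: power_mult_distrib)
    have inv: "1 / ((- 1) ^ k * y) = (- 1) ^ k * (1 / y)" for y :: complex
      by (cases "even k") auto
    show ?thesis unfolding regular_term_def pow inv by (auto simp: algebra_simps)
  qed
  then show ?thesis
    unfolding regular_part_def
    using infsum_reindex_bij_betw[OF uminus_lattice_bij, of "regular_term k (- z)"]
    by (simp add: infsum_cmult_right')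
qed

lemma regular_part_odd_0: "odd k \<Longrightarrow> regular_part k 0 = 0"
  using regular_part_uminus[of k 0] by simp

lemma regular_part_2_0: "regular_part 2 0 = 0"
  by (simp add: regular_part_def regular_term_def)

lemma wpk_2_even: "wpk 2 (- z) = wpk 2 z"
  by (simp add: wpk_def regular_part_uminus)

text \<open>Here no convergence factor is present, and translation by \<open>v\<close> permutes the terms.\<close>
lemma wpk_periodic_ge_3:
  assumes "k \<ge> 3" "z \<notin> L" "v \<in> L"
  shows "wpk k (z + v) = wpk k z"
proof -
  have zv: "z + v \<notin> L" using assms diff_in_L[of "z + v" v] by auto
  have "bij_betw (\<lambda>w. w + v) L L"
    by (rule bij_betwI[where g = "\<lambda>w. w - v"]) (auto intro: add_in_L diff_in_L assms)
  then have "(regular_term k (z + v) has_sum wpk k (z + v)) L \<longleftrightarrow>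
      ((\<lambda>w. regular_term k (z + v) (w + v)) has_sum wpk k (z + v)) L"
    by (rule has_sum_reindex_bij_betw[symmetric])
  moreover have "(\<lambda>w. regular_term k (z + v) (w + v)) = regular_term k z"
    using assms(1) by (auto simp: regular_term_def)
  ultimately have "(regular_term k z has_sum wpk k (z + v)) L"
    using wpk_has_sum[OF _ zv, of k] assms by simp
  then show ?thesis
    using has_sum_unique wpk_has_sum[of k z] assms by fastforce
qed

text \<open>The difference of the two sides has derivative 0 on the connected complement of the lattice, hence is
  constant. At \<open>z = - v / 2\<close> it vanishes, because \<open>\<wp>\<close> is even.\<close>
lemma wpk_2_periodic_half:
  assumes v: "v \<in> L" "v / 2 \<notin> L" and z: "z \<notin> L"
  shows "wpk 2 (z + v) = wpk 2 z"
proof -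
  have shift: "x + v \<notin> L" if "x \<notin> L" for x using that v diff_in_L[of "x + v" v] by auto
  have D: "((\<lambda>x. wpk 2 (x + v) - wpk 2 x) has_field_derivative 0) (at x)" if x: "x \<notin> L" for x
  proof -
    have "((\<lambda>x. wpk 2 (x + v) - wpk 2 x) has_field_derivative
        (- of_nat 2 * wpk (Suc 2) (x + v)) - (- of_nat 2 * wpk (Suc 2) x)) (at x)"
      using wpk_deriv[of 2 "x + v"] shift[OF x] x
      by (intro DERIV_diff wpk_deriv DERIV_shift[THEN iffD1]) auto
    then show ?thesis using wpk_periodic_ge_3[OF _ x v(1), of 3] by simp
  qed
  have "connected (- L)"
    using countable_L by (intro path_connected_imp_connected path_connected_complement_countable) auto
  then obtain c where c: "\<And>x. x \<in> - L \<Longrightarrow> wpk 2 (x + v) - wpk 2 x = c"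
    by (rule DERIV_zero_connected_constant[OF _ open_compl_L finite.emptyI, of "\<lambda>x. wpk 2 (x + v) - wpk 2 x"])
       (use D in \<open>auto intro!: continuous_at_imp_continuous_on DERIV_isCont\<close>)
  have "- v / 2 \<notin> L" using uminus_in_L[of "- v / 2"] v by auto
  then have "c = wpk 2 (- (v / 2) + v) - wpk 2 (- (v / 2))" using c[of "- (v / 2)"] by simp
  also have "- (v / 2) + v = v / 2" by simp
  finally have "c = 0" by (simp add: wpk_2_even)
  then show ?thesis using c[of z] z by simp
qed

lemma half_periods: "1 / 2 \<notin> L" "\<tau> / 2 \<notin> L"
proof -
  have *: "2 * m \<noteq> 1" for m :: int by presburger
  show "1 / 2 \<notin> L"
  proof
    assume "1 / 2 \<in> L"
    then obtain m n :: int where "1 / 2 = of_int m * \<tau> + of_int n" by (auto simp: period_lattice_def)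
    then have "of_int 0 * \<tau> + of_int 1 = of_int (2 * m) * \<tau> + of_int (2 * n)" by (simp add: field_simps)
    then show False using lattice_point_inj[OF Im_pos] *[of n] by metis
  qed
  show "\<tau> / 2 \<notin> L"
  proof
    assume "\<tau> / 2 \<in> L"
    then obtain m n :: int where "\<tau> / 2 = of_int m * \<tau> + of_int n" by (auto simp: period_lattice_def)
    then have "of_int 1 * \<tau> + of_int 0 = of_int (2 * m) * \<tau> + of_int (2 * n)" by (simp add: field_simps)
    then show False using lattice_point_inj[OF Im_pos] *[of m] by metis
  qed
qed

lemma wpk_periodic:
  assumes "k \<ge> 2" "z \<notin> L" "v = 1 \<or> v = \<tau>"
  shows "wpk k (z + v) = wpk k z"
proof (cases "k = 2")
  case True
  then show ?thesis using wpk_2_periodic_half[of v z] half_periods one_in_L tau_in_L assms by auto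
next
  case False
  then show ?thesis using wpk_periodic_ge_3[of k z v] one_in_L tau_in_L assms by auto
qed

section \<open>Liouville's theorem for elliptic functions\<close>

lemma int_multiple_period:
  assumes per: "\<And>z. z \<notin> L \<Longrightarrow> F (z + v) = F z" and v: "v \<in> L" and z: "z \<notin> L"
  shows "F (z + of_int m * v) = (F z :: complex)" and "z + of_int m * v \<notin> L"
proof -
  have "F (z + of_int m * v) = F z \<and> z + of_int m * v \<notin> L"
  proof (induction m rule: int_induct[where k = 0])
    case (step1 i)
    have "z + of_int (i + 1) * v = (z + of_int i * v) + v" by (simp add: algebra_simps)
    then show ?case
      using step1 per[of "z + of_int i * v"] diff_in_L[of "z + of_int (i + 1) * v" v] v
      by (auto simp: add.assoc)
  next
    case (step2 i)
    have eq: "z + of_int i * v = (z + of_int (i - 1) * v) + v" by (simp add: algebra_simps)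
    have nL: "z + of_int (i - 1) * v \<notin> L"
      using step2 add_in_L[of "z + of_int (i - 1) * v" v] v unfolding eq by blast
    show ?case using step2 nL per[OF nL] unfolding eq by simp
  qed (use z in auto)
  then show "F (z + of_int m * v) = F z" "z + of_int m * v \<notin> L" by auto
qed

text \<open>The singularities at the lattice points are removable, so \<open>F\<close> extends to an entire function. Its
  values are those on a compact period parallelogram, hence it is bounded and Liouville's theorem
  applies.\<close>
lemma elliptic_constant:
  assumes hol: "F holomorphic_on - L"
    and per: "\<And>z v. z \<notin> L \<Longrightarrow> v = 1 \<or> v = \<tau> \<Longrightarrow> F (z + v) = F z"
    and lim: "(F \<longlongrightarrow> c) (at 0)" and z: "z \<notin> L"
  shows "F z = c"
proof -
  have per_L: "F (x + v) = F x" if "v \<in> L" "x \<notin> L" for x v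
  proof -
    obtain m n :: int where v: "v = of_int m * \<tau> + of_int n" using \<open>v \<in> L\<close> by (auto simp: period_lattice_def)
    have "x + of_int m * \<tau> \<notin> L" "F (x + of_int m * \<tau>) = F x"
      using int_multiple_period[of F \<tau> x m] per tau_in_L that by auto
    then show ?thesis
      using int_multiple_period(1)[of F 1 "x + of_int m * \<tau>" n] per one_in_L that
      by (simp add: v algebra_simps)
  qed
  define G where "G = (\<lambda>z. if z \<in> L then c else F z)"
  have per_G: "G (x + v) = G x" if "v \<in> L" for x v
    using that per_L[of v x] add_in_L[of x v] diff_in_L[of "x + v" v] by (auto simp: G_def)
  obtain d where d: "d > 0" "\<And>w. w \<in> L - {0} \<Longrightarrow> norm w \<ge> d"
    using norm_lattice_ge by blast
  have ball: "x \<notin> L" if "w \<in> L" "x \<in> ball w d - {w}" for x w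
    using d(2)[of "x - w"] diff_in_L[of x w] that by (auto simp: dist_norm norm_minus_commute)
  have "(G \<longlongrightarrow> c) (at 0)"
    using lim
  proof (rule tendsto_cong[THEN iffD1, rotated])
    show "\<forall>\<^sub>F x in at 0. F x = G x"
      using ball[of 0] d(1) by (auto simp: eventually_at G_def intro!: exI[of _ d])
  qed
  then have tendsto_G: "(G \<longlongrightarrow> c) (at w)" if "w \<in> L" for w
    using LIM_offset_zero_cancel[of G w c] per_G[OF that] by (simp add: add.commute)
  have "G field_differentiable at x" for x
  proof (cases "x \<in> L")
    case True
    have "G holomorphic_on ball x d"
    proof (rule no_isolated_singularity'[of "{x}"])
      show "G holomorphic_on ball x d - {x}"
        by (rule holomorphic_transform[OF holomorphic_on_subset[OF hol]]) (use ball[OF True] in \<open>auto simp: G_def\<close>)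
      show "(G \<longlongrightarrow> G y) (at y within ball x d)" if "y \<in> {x}" for y
        using tendsto_G[OF True] that True by (auto simp: G_def intro: tendsto_within_subset)
    qed auto
    then show ?thesis using d by (auto intro: holomorphic_on_imp_differentiable_at)
  next
    case False
    have "G holomorphic_on - L"
      by (rule holomorphic_transform[OF hol]) (auto simp: G_def)
    then show ?thesis using False open_compl_L by (auto intro: holomorphic_on_imp_differentiable_at)
  qed
  then have hol_G: "G holomorphic_on UNIV"
    by (simp add: holomorphic_on_def field_differentiable_at_within)
  define K where "K = (\<lambda>(a, b). complex_of_real a * \<tau> + complex_of_real b) ` ({0..1} \<times> {0..1})"
  have "compact K"
    unfolding K_def case_prod_unfold
    by (intro compact_continuous_image continuous_intros compact_Times compact_Icc)
  moreover have "continuous_on K G"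
    using holomorphic_on_imp_continuous_on[OF hol_G] continuous_on_subset by blast
  ultimately have "bounded (G ` K)" by (intro compact_imp_bounded compact_continuous_image)
  moreover have "range G \<subseteq> G ` K"
  proof
    fix y assume "y \<in> range G"
    then obtain x where y: "y = G x" by auto
    define a where "a = Im x / Im \<tau>"
    define b where "b = Re (x - of_real a * \<tau>)"
    have x: "x = of_real a * \<tau> + of_real b"
      using Im_pos by (simp add: complex_eq_iff a_def b_def)
    define v where "v = of_int \<lfloor>a\<rfloor> * \<tau> + of_int \<lfloor>b\<rfloor>"
    have "x - v = of_real (frac a) * \<tau> + of_real (frac b)"
      by (simp add: x v_def frac_def algebra_simps)
    moreover have "frac a \<in> {0..1}" "frac b \<in> {0..1}"
      by (auto simp: frac_ge_0 less_imp_le[OF frac_lt_1])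
    ultimately have "x - v \<in> K" unfolding K_def by (auto intro!: image_eqI[of _ _ "(frac a, frac b)"])
    moreover have "G x = G (x - v)" using per_G[of v "x - v"] by (simp add: v_def)
    ultimately show "y \<in> G ` K" using y by auto
  qed
  ultimately have "bounded (range G)" using bounded_subset by blast
  then obtain a where a: "\<And>x. G x = a"
    using Liouville_theorem[OF hol_G] by (auto simp: constant_on_def)
  have "a = c" using a[of 0] by (simp add: G_def)
  then show ?thesis using a[of z] z by (simp add: G_def)
qed

section \<open>The differential equation\<close>

lemma regular_part_isCont_0: "k \<ge> 2 \<Longrightarrow> (regular_part k \<longlongrightarrow> regular_part k 0) (at 0)"
  using DERIV_isCont[OF regular_part_deriv[of k 0]] by (simp add: isCont_def)

text \<open>By \<open>regular_part_deriv\<close> the derivatives of a lattice sum are lattice sums, so the Taylor coefficients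
  at the origin are the values \<open>regular_part (k + i) 0\<close>, which are Eisenstein series.\<close>
lemma regular_part_Taylor:
  assumes k: "k \<ge> 2"
  shows "((\<lambda>z. (regular_part k z - (\<Sum>i\<le>n. (- 1) ^ i * pochhammer (of_nat k) i / fact i *
    regular_part (k + i) 0 * z ^ i)) / z ^ n) \<longlongrightarrow> 0) (at 0)"
proof -
  define f where "f = (\<lambda>i z. (- 1) ^ i * pochhammer (of_nat k) i * regular_part (k + i) z)"
  obtain d where d: "d > 0" "\<And>w. w \<in> L - {0} \<Longrightarrow> norm w \<ge> d"
    using norm_lattice_ge by blast
  define S where "S = cball (0 :: complex) (d / 2)"
  have S: "x \<notin> L - {0}" if "x \<in> S" for x using d(1) d(2)[of x] that by (auto simp: S_def)
  have D: "(f i has_field_derivative f (Suc i) x) (at x within S)" if "x \<in> S" for i x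
  proof -
    have "((\<lambda>z. (- 1) ^ i * pochhammer (of_nat k) i * regular_part (k + i) z) has_field_derivative
      (- 1) ^ i * pochhammer (of_nat k) i * (- of_nat (k + i) * regular_part (Suc (k + i)) x)) (at x)"
      using k S[OF that] by (intro DERIV_cmult regular_part_deriv) auto
    then show ?thesis
      by (auto simp: f_def pochhammer_Suc algebra_simps intro!: has_field_derivative_at_within)
  qed
  have "continuous_on S (f (Suc n))"
    using DERIV_continuous_on[of S "f (Suc n)" "f (Suc (Suc n))"] D by blast
  then have "compact (f (Suc n) ` S)" by (intro compact_continuous_image) (simp_all add: S_def)
  then obtain B where B: "\<And>x. x \<in> S \<Longrightarrow> norm (f (Suc n) x) \<le> B"
    using compact_imp_bounded[of "f (Suc n) ` S"] by (auto simp: bounded_iff)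
  have bound: "norm ((f 0 z - (\<Sum>i\<le>n. f i 0 * z ^ i / fact i)) / z ^ n) \<le> B / fact n * norm z"
    if z: "z \<in> S" "z \<noteq> 0" for z
  proof -
    have "norm (f 0 z - (\<Sum>i\<le>n. f i 0 * (z - 0) ^ i / fact i)) \<le> B * norm (z - 0) ^ Suc n / fact n"
      using D B z d(1) by (intro complex_Taylor[of S]) (auto simp: S_def)
    then have "norm ((f 0 z - (\<Sum>i\<le>n. f i 0 * z ^ i / fact i)) / z ^ n) \<le> (B * norm z ^ Suc n / fact n) / norm z ^ n"
      unfolding norm_divide norm_power by (intro divide_right_mono) auto
    then show ?thesis using z by simp
  qed
  have "((\<lambda>z. (f 0 z - (\<Sum>i\<le>n. f i 0 * z ^ i / fact i)) / z ^ n) \<longlongrightarrow> 0) (at 0)"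
  proof (rule Lim_null_comparison)
    show "\<forall>\<^sub>F z in at 0. norm ((f 0 z - (\<Sum>i\<le>n. f i 0 * z ^ i / fact i)) / z ^ n) \<le> B / fact n * norm z"
      unfolding eventually_at using d(1) bound
      by (intro exI[of _ "d / 2"]) (auto simp: S_def)
    show "((\<lambda>z::complex. B / fact n * norm z) \<longlongrightarrow> 0) (at 0)"
      by (intro tendsto_eq_intros) auto
  qed
  then show ?thesis by (simp add: f_def mult_ac)
qed

definition G4 :: complex where "G4 = regular_part 4 0"
definition G6 :: complex where "G6 = regular_part 6 0"

text \<open>The coefficients of odd powers vanish because the lattice is symmetric under \<open>w \<mapsto> - w\<close>, and the
  constant one because every term of \<open>regular_part 2 0\<close> is 0.\<close>
lemma regular_part_2_expansion:
  obtains e where "(e \<longlongrightarrow> 0) (at 0)"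
    "\<And>z. z \<noteq> 0 \<Longrightarrow> regular_part 2 z = 3 * G4 * z ^ 2 + 5 * G6 * z ^ 4 + e z * z ^ 4"
proof
  let ?e = "\<lambda>z. (regular_part 2 z - (3 * G4 * z ^ 2 + 5 * G6 * z ^ 4)) / z ^ 4"
  have odd: "regular_part 3 0 = 0" "regular_part 5 0 = 0"
    by (simp_all add: regular_part_odd_0)
  show "(?e \<longlongrightarrow> 0) (at 0)"
    using regular_part_Taylor[of 2 4] odd regular_part_2_0
    by (simp add: eval_nat_numeral pochhammer_Suc G4_def G6_def mult_ac)
  show "regular_part 2 z = 3 * G4 * z ^ 2 + 5 * G6 * z ^ 4 + ?e z * z ^ 4" if "z \<noteq> 0" for z
    using that by simp
qed

lemma regular_part_3_expansion:
  obtains e where "(e \<longlongrightarrow> 0) (at 0)"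
    "\<And>z. z \<noteq> 0 \<Longrightarrow> regular_part 3 z = - 3 * G4 * z - 10 * G6 * z ^ 3 + e z * z ^ 3"
proof
  let ?e = "\<lambda>z. (regular_part 3 z - (- 3 * G4 * z - 10 * G6 * z ^ 3)) / z ^ 3"
  have odd: "regular_part 3 0 = 0" "regular_part 5 0 = 0"
    by (simp_all add: regular_part_odd_0)
  show "(?e \<longlongrightarrow> 0) (at 0)"
    using regular_part_Taylor[of 3 3] odd
    by (simp add: eval_nat_numeral pochhammer_Suc G4_def G6_def mult_ac)
  show "regular_part 3 z = - 3 * G4 * z - 10 * G6 * z ^ 3 + ?e z * z ^ 3" if "z \<noteq> 0" for z
    using that by simp
qed

lemma wpk_holomorphic: "k \<ge> 2 \<Longrightarrow> wpk k holomorphic_on - L"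
  using wpk_deriv open_compl_L by (auto simp: holomorphic_on_open)

text \<open>The equation \<open>\<wp>'' = 6 \<wp>\<^sup>2 - 30 G\<^sub>4\<close> divided by 6. The poles of \<open>\<wp>\<^sub>4\<close> and \<open>\<wp>\<^sup>2\<close> cancel, and the expansion
  \<open>\<wp> = z\<^sup>-\<^sup>2 + 3 G\<^sub>4 z\<^sup>2 + \<dots>\<close> gives the value \<open>G\<^sub>4 - 6 G\<^sub>4\<close> of the difference at the origin.\<close>
lemma wpk_4_eq:
  assumes "z \<notin> L"
  shows "wpk 4 z = wpk 2 z ^ 2 - 5 * G4"
proof -
  let ?F = "\<lambda>z. wpk 4 z - wpk 2 z ^ 2"
  have "?F z = - 5 * G4"
  proof (rule elliptic_constant[OF _ _ _ assms])
    show "?F holomorphic_on - L" by (intro holomorphic_intros wpk_holomorphic) auto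
    show "?F (z + v) = ?F z" if "z \<notin> L" "v = 1 \<or> v = \<tau>" for z v
      using wpk_periodic[OF _ that] by simp
    obtain e where e: "(e \<longlongrightarrow> 0) (at 0)"
      "\<And>z. z \<noteq> 0 \<Longrightarrow> regular_part 2 z = 3 * G4 * z ^ 2 + 5 * G6 * z ^ 4 + e z * z ^ 4"
      using regular_part_2_expansion by blast
    have "((\<lambda>z. regular_part 4 z - 2 * (3 * G4 + 5 * G6 * z ^ 2 + e z * z ^ 2) - regular_part 2 z ^ 2)
        \<longlongrightarrow> G4 - 2 * (3 * G4 + 5 * G6 * 0 ^ 2 + 0 * 0 ^ 2) - 0 ^ 2) (at 0)"
      using regular_part_isCont_0[of 4] regular_part_isCont_0[of 2] e(1)
      by (intro tendsto_intros) (simp_all add: G4_def regular_part_2_0)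
    then have "((\<lambda>z. regular_part 4 z - 2 * (3 * G4 + 5 * G6 * z ^ 2 + e z * z ^ 2) - regular_part 2 z ^ 2)
        \<longlongrightarrow> - 5 * G4) (at 0)"
      by simp
    then show "(?F \<longlongrightarrow> - 5 * G4) (at 0)"
    proof (rule tendsto_cong[THEN iffD1, rotated])
      show "\<forall>\<^sub>F z in at 0. regular_part 4 z - 2 * (3 * G4 + 5 * G6 * z ^ 2 + e z * z ^ 2) - regular_part 2 z ^ 2 = ?F z"
      proof (rule eventually_at_filter[THEN iffD2], rule always_eventually, intro allI impI)
        fix z :: complex assume z: "z \<noteq> 0"
        have "2 * (3 * G4 + 5 * G6 * z ^ 2 + e z * z ^ 2) = 2 * regular_part 2 z / z ^ 2"
          using z by (simp add: e(2)[OF z] field_simps power4_eq_xxxx power2_eq_square)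
        then show "regular_part 4 z - 2 * (3 * G4 + 5 * G6 * z ^ 2 + e z * z ^ 2) - regular_part 2 z ^ 2 = ?F z"
          using z by (simp add: wpk_def power2_sum power_divide)
      qed
    qed
  qed
  then show ?thesis by (simp add: algebra_simps)
qed

text \<open>The equation \<open>\<wp>'\<^sup>2 = 4 \<wp>\<^sup>3 - 60 G\<^sub>4 \<wp> - 140 G\<^sub>6\<close> divided by 4, by the same argument two
  orders further: \<open>G\<^sub>6\<close> enters
  with \<open>- 20\<close> through \<open>\<wp>\<^sub>3\<^sup>2\<close> and with \<open>- 15\<close> through \<open>\<wp>\<^sup>3\<close>.\<close>
lemma wpk_3_sq:
  assumes "z \<notin> L"
  shows "wpk 3 z ^ 2 = wpk 2 z ^ 3 - 15 * G4 * wpk 2 z - 35 * G6"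
proof -
  let ?F = "\<lambda>z. wpk 3 z ^ 2 - wpk 2 z ^ 3 + 15 * G4 * wpk 2 z"
  have "?F z = - 35 * G6"
  proof (rule elliptic_constant[OF _ _ _ assms])
    show "?F holomorphic_on - L" by (intro holomorphic_intros wpk_holomorphic) auto
    show "?F (z + v) = ?F z" if "z \<notin> L" "v = 1 \<or> v = \<tau>" for z v
      using wpk_periodic[OF _ that] by simp
    obtain e where e: "(e \<longlongrightarrow> 0) (at 0)"
      "\<And>z. z \<noteq> 0 \<Longrightarrow> regular_part 2 z = 3 * G4 * z ^ 2 + 5 * G6 * z ^ 4 + e z * z ^ 4"
      using regular_part_2_expansion by blast
    obtain e' where e': "(e' \<longlongrightarrow> 0) (at 0)"
      "\<And>z. z \<noteq> 0 \<Longrightarrow> regular_part 3 z = - 3 * G4 * z - 10 * G6 * z ^ 3 + e' z * z ^ 3"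
      using regular_part_3_expansion by blast
    let ?H = "\<lambda>z. 2 * (- 10 * G6 + e' z) + regular_part 3 z ^ 2 - 3 * (5 * G6 + e z)
       - 3 * (regular_part 2 z * (3 * G4 + 5 * G6 * z ^ 2 + e z * z ^ 2)) - regular_part 2 z ^ 3
       + 15 * G4 * regular_part 2 z"
    have "(?H \<longlongrightarrow> 2 * (- 10 * G6 + 0) + 0 ^ 2 - 3 * (5 * G6 + 0)
       - 3 * (0 * (3 * G4 + 5 * G6 * 0 ^ 2 + 0 * 0 ^ 2)) - 0 ^ 3 + 15 * G4 * 0) (at 0)"
      using regular_part_isCont_0[of 3] regular_part_isCont_0[of 2] e(1) e'(1)
      by (intro tendsto_intros) (simp_all add: regular_part_2_0 regular_part_odd_0)
    then have "(?H \<longlongrightarrow> - 35 * G6) (at 0)" by simp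
    then show "(?F \<longlongrightarrow> - 35 * G6) (at 0)"
    proof (rule tendsto_cong[THEN iffD1, rotated])
      show "\<forall>\<^sub>F z in at 0. ?H z = ?F z"
      proof (rule eventually_at_filter[THEN iffD2], rule always_eventually, intro allI impI)
        fix z :: complex assume z: "z \<noteq> 0"
        define a b where "a = regular_part 2 z" and "b = regular_part 3 z"
        \<comment> \<open>With \<open>u * z = 1\<close> the cancellation of the poles becomes polynomial algebra.\<close>
    define u where "u = 1 / z"
        have uz: "u * z = 1" using z by (simp add: u_def)
        have a: "a = 3 * G4 * z ^ 2 + 5 * G6 * z ^ 4 + e z * z ^ 4" using e(2)[OF z] by (simp add: a_def)
        have b: "b = - 3 * G4 * z - 10 * G6 * z ^ 3 + e' z * z ^ 3" using e'(2)[OF z] by (simp add: b_def)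
        have P23: "wpk 2 z = u ^ 2 + a" "wpk 3 z = u ^ 3 + b"
          by (simp_all add: wpk_def u_def a_def b_def power_divide)
        have u2: "u ^ 2 * a = 3 * G4 + 5 * G6 * z ^ 2 + e z * z ^ 2" using a uz by algebra
        have u4: "u ^ 4 * a = 3 * G4 * u ^ 2 + 5 * G6 + e z" using a uz by algebra
        have u3: "u ^ 3 * b = - 3 * G4 * u ^ 2 - 10 * G6 + e' z" using b uz by algebra
        have "?F z = 2 * (u ^ 3 * b) + b ^ 2 - 3 * (u ^ 4 * a) - 3 * (a * (u ^ 2 * a)) - a ^ 3 + 15 * G4 * (u ^ 2 + a)"
          unfolding P23 by algebra
        also have "\<dots> = ?H z" unfolding u2 u3 u4 a_def[symmetric] b_def[symmetric] by algebra
        finally show "?H z = ?F z" ..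
      qed
    qed
  qed
  then show ?thesis by (simp add: algebra_simps)
qed

section \<open>Power sums over boxes\<close>

text \<open>The term at the origin may be included, since \<open>1 / 0 = 0\<close>.\<close>
lemma eisenstein_sum_eq:
  assumes "k \<ge> 1"
  shows "(\<Sum>(m, n)\<in>int_box M \<times> int_box N - {(0, 0)}. 1 / (of_int m * \<tau> + of_int n) ^ k) =
    (\<Sum>w\<in>lattice_box \<tau> M N. 1 / w ^ k)"
proof -
  have "(\<Sum>(m, n)\<in>int_box M \<times> int_box N - {(0, 0)}. 1 / (of_int m * \<tau> + of_int n) ^ k) =
      (\<Sum>(m, n)\<in>int_box M \<times> int_box N. 1 / (of_int m * \<tau> + of_int n) ^ k)"
    using assms by (intro sum.mono_neutral_left) (auto simp: finite_int_box)
  then show ?thesis by (simp add: sum_lattice_box[OF Im_pos] sum.cartesian_product)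
qed

lemma eisenstein_G_eq_regular_part:
  assumes "k \<ge> 3" "even k"
  shows "eisenstein_G k \<tau> = regular_part k 0"
proof -
  have reg: "regular_term k 0 = (\<lambda>w. 1 / w ^ k)"
    using assms by (auto simp: regular_term_def)
  have "(regular_term k 0 has_sum regular_part k 0) (L - {0})"
    by (rule regular_term_has_sum) (use assms in auto)
  then have "((\<lambda>w. 1 / w ^ k) has_sum regular_part k 0) L"
    unfolding reg by (rule has_sum_cong_neutral[THEN iffD1, rotated -1]) (use assms in auto)
  then have "box_limit (\<lambda>M N. \<Sum>w\<in>lattice_box \<tau> M N. 1 / w ^ k) (regular_part k 0)"
    using box_limit_infsum[OF Im_pos] by (metis has_sum_imp_summable infsumI)
  then show ?thesis
    unfolding eisenstein_G_def using assms by (simp add: eisenstein_sum_eq lim_lim_eq)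
qed

lemma G4_eq: "G4 = eisenstein_G 4 \<tau>" and G6_eq: "G6 = eisenstein_G 6 \<tau>"
  by (simp_all add: G4_def G6_def eisenstein_G_eq_regular_part)

lemma telescope_int_box:
  fixes f :: "int \<Rightarrow> complex"
  shows "(\<Sum>n\<in>int_box (Suc N). f n - f (n + 1)) = f (- int N) - f (int N + 1)"
proof (induction N)
  case 0
  have "int_box (Suc 0) = {0}" by (auto simp: int_box_def)
  then show ?case by simp
next
  case (Suc N)
  have "int_box (Suc (Suc N)) = insert (int (Suc N)) (insert (- int (Suc N)) (int_box (Suc N)))"
    by (auto simp: int_box_def)
  moreover have "int (Suc N) \<notin> insert (- int (Suc N)) (int_box (Suc N))" "- int (Suc N) \<notin> int_box (Suc N)"
    by (auto simp: int_box_def)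
  ultimately show ?case using Suc by (simp add: finite_int_box algebra_simps)
qed

text \<open>A conditionally convergent series with which \<open>G\<^sub>2\<close> is compared. Each row telescopes because the lattice
  is invariant under translation by 1, and the shift by \<open>1 / 2\<close> keeps the denominators away from 0.\<close>
lemma box_limit_telescoping:
  "box_limit (\<lambda>M N. \<Sum>w\<in>lattice_box \<tau> M N. 1 / (w - 1 / 2) - 1 / (w + 1 / 2)) 0"
proof -
  have row: "(\<lambda>N. \<Sum>n\<in>int_box N. 1 / (of_int m * \<tau> + of_int n - 1 / 2) - 1 / (of_int m * \<tau> + of_int n + 1 / 2)) \<longlonglongrightarrow> 0" for m :: int
  proof -
    define f where "f = (\<lambda>n::int. 1 / (of_int m * \<tau> + of_int n - 1 / 2))"
    have eq: "(\<Sum>n\<in>int_box (Suc N). 1 / (of_int m * \<tau> + of_int n - 1 / 2) - 1 / (of_int m * \<tau> + of_int n + 1 / 2))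
        = f (- int N) - f (int N + 1)" for N
      using telescope_int_box[of f N] by (simp add: f_def algebra_simps)
    have "(\<lambda>N. 1 / (of_int m * \<tau> - 1 / 2 + - of_nat N) - 1 / (of_int m * \<tau> + 1 / 2 + of_nat N)) \<longlonglongrightarrow> 0 - (0 :: complex)"
    proof (intro tendsto_diff tendsto_divide_0[OF tendsto_const])
      show "filterlim (\<lambda>N. of_int m * \<tau> - 1 / 2 + - of_nat N) at_infinity sequentially"
        by (intro tendsto_add_filterlim_at_infinity[OF tendsto_const]) 
           (simp add: filterlim_at_infinity_imp_norm_at_top filterlim_norm_at_top_imp_at_infinity filterlim_real_sequentially)
      show "filterlim (\<lambda>N. of_int m * \<tau> + 1 / 2 + of_nat N) at_infinity sequentially"
        by (intro tendsto_add_filterlim_at_infinity[OF tendsto_const] tendsto_of_nat)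
    qed
    then have "(\<lambda>N. f (- int N) - f (int N + 1)) \<longlonglongrightarrow> 0"
      by (simp add: f_def algebra_simps)
    then show ?thesis
      by (subst filterlim_sequentially_Suc[symmetric]) (simp add: eq)
  qed
  show ?thesis
    unfolding sum_lattice_box[OF Im_pos] box_limit_def
    by (intro exI[of _ "\<lambda>_. 0"] conjI allI tendsto_null_sum row tendsto_const)
qed

text \<open>The terms \<open>w\<^sup>-\<^sup>2\<close> are not absolutely summable, but they differ from those of the telescoping series,
  which are \<open>(w\<^sup>2 - 1/4)\<^sup>-\<^sup>1\<close>, by \<open>O(w\<^sup>-\<^sup>4)\<close>. So the iterated limit defining \<open>G\<^sub>2\<close> exists.\<close>
lemma eisenstein_G2_limit:
  "box_limit (\<lambda>M N. \<Sum>w\<in>lattice_box \<tau> M N. 1 / w ^ 2) (eisenstein_G 2 \<tau>)"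
proof -
  let ?u = "\<lambda>w. 1 / (w - 1 / 2) - 1 / (w + 1 / 2) :: complex"
  obtain c where c: "c > 0" "\<And>w. w \<in> L - {0} \<Longrightarrow> c * norm w \<le> norm (1 / 2 - w)"
  proof -
    obtain e c where "e > 0" "c > 0"
      "\<And>z w. z \<in> cball (1 / 2) e \<Longrightarrow> w \<in> L - {0} \<Longrightarrow> c * norm w \<le> norm (z - w)"
      using distance_to_lattice[of "1 / 2"] half_periods(1) by blast
    then show ?thesis using that[of c] by simp
  qed
  obtain d where d: "d > 0" "\<And>w. w \<in> L - {0} \<Longrightarrow> norm w \<ge> d"
    using norm_lattice_ge by blast
  have "norm (1 / w ^ 2 - ?u w) \<le> 1 / (4 * c ^ 2 * d) / norm w ^ 3" if w: "w \<in> L - {0}" for w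
  proof -
    have w0: "norm w > 0" using w by auto
    have c1: "c * norm w \<le> norm (w - 1 / 2)" using c(2)[OF w] by (simp add: norm_minus_commute)
    have c2: "c * norm w \<le> norm (w + 1 / 2)" using c(2)[of "- w"] w uminus_in_L by (simp add: add.commute)
    have cw: "0 < c * norm w" using c(1) w0 by simp
    have nz: "w - 1 / 2 \<noteq> 0" "w + 1 / 2 \<noteq> 0" "w \<noteq> 0" 
      using less_le_trans[OF cw c1] less_le_trans[OF cw c2] w0 unfolding zero_less_norm_iff by blast+
    have u: "?u w = 1 / ((w - 1 / 2) * (w + 1 / 2))"
      using nz by (subst diff_frac_eq) simp_all
    have "1 / w ^ 2 - 1 / ((w - 1 / 2) * (w + 1 / 2))
        = (1 * ((w - 1 / 2) * (w + 1 / 2)) - 1 * w ^ 2) / (w ^ 2 * ((w - 1 / 2) * (w + 1 / 2)))"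
      using nz by (intro diff_frac_eq) auto
    also have "1 * ((w - 1 / 2) * (w + 1 / 2)) - 1 * w ^ 2 = - 1 / 4"
      by (simp add: algebra_simps power2_eq_square)
    finally have "norm (1 / w ^ 2 - ?u w) = 1 / 4 / (norm w ^ 2 * (norm (w - 1 / 2) * norm (w + 1 / 2)))"
      unfolding u by (simp add: norm_divide norm_mult norm_power)
    also have "\<dots> \<le> 1 / 4 / (norm w ^ 2 * ((c * norm w) * (c * norm w)))"
      using c1 c2 cw c(1) w0 nz by (intro divide_left_mono mult_left_mono mult_mono mult_pos_pos) auto
    also have "\<dots> = 1 / (4 * c ^ 2 * norm w * norm w ^ 3)"
      by (simp add: power2_eq_square power3_eq_cube mult_ac)
    also have "\<dots> \<le> 1 / (4 * c ^ 2 * d * norm w ^ 3)"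
      using d(1) d(2)[OF w] c(1) w0
      by (intro divide_left_mono mult_right_mono mult_left_mono mult_pos_pos) auto
    finally show ?thesis by simp
  qed
  then have "(\<lambda>w. 1 / w ^ 2 - ?u w) summable_on L - {0}"
    by (rule summable_by_cube)
  then have "(\<lambda>w. 1 / w ^ 2 - ?u w) summable_on insert 0 (L - {0})"
    by (simp only: summable_on_insert_iff)
  moreover have "insert 0 (L - {0}) = L" by auto
  ultimately have "(\<lambda>w. 1 / w ^ 2 - ?u w) summable_on L" by simp
  from box_limit_add[OF box_limit_infsum[OF Im_pos this] box_limit_telescoping]
  obtain G where G: "box_limit (\<lambda>M N. \<Sum>w\<in>lattice_box \<tau> M N. 1 / w ^ 2) G"
    by (simp add: sum.distrib[symmetric])
  then have "eisenstein_G 2 \<tau> = G"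
    unfolding eisenstein_G_def by (simp add: eisenstein_sum_eq lim_lim_eq)
  with G show ?thesis by simp
qed

text \<open>The series of \<open>\<wp>\<close> has terms \<open>(z - w)\<^sup>-\<^sup>2 - w\<^sup>-\<^sup>2\<close>; restoring \<open>w\<^sup>-\<^sup>2\<close> adds \<open>G\<^sub>2\<close>.\<close>
definition power_sum :: "nat \<Rightarrow> complex \<Rightarrow> complex" where
  "power_sum k z = wpk k z + (if k = 2 then eisenstein_G 2 \<tau> else 0)"

lemma box_limit_power_sum:
  assumes "k \<ge> 2" "z \<notin> L"
  shows "box_limit (\<lambda>M N. \<Sum>w\<in>lattice_box \<tau> M N. 1 / (z - w) ^ k) (power_sum k z)"
proof -
  have P: "box_limit (\<lambda>M N. \<Sum>w\<in>lattice_box \<tau> M N. regular_term k z w) (wpk k z)"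
    using box_limit_infsum[OF Im_pos] wpk_has_sum[OF assms] by (metis has_sum_imp_summable infsumI)
  show ?thesis
  proof (cases "k = 2")
    case True
    then show ?thesis
      using box_limit_add[OF P eisenstein_G2_limit]
      by (simp add: power_sum_def regular_term_def sum.distrib[symmetric])
  next
    case False
    then show ?thesis using P by (simp add: power_sum_def regular_term_def)
  qed
qed

end

section \<open>The graded ring generated by \<open>G\<^sub>2\<close>, \<open>G\<^sub>4\<close>, \<open>G\<^sub>6\<close>, \<open>\<wp>\<close> and \<open>\<wp>'\<close>\<close>

definition eisenstein_monomial :: "nat \<Rightarrow> nat \<Rightarrow> nat \<Rightarrow> complex \<Rightarrow> complex" where
  "eisenstein_monomial a b c \<tau> = eisenstein_G 2 \<tau> ^ a * eisenstein_G 4 \<tau> ^ b * eisenstein_G 6 \<tau> ^ c"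

text \<open>Homogeneous elements of weight \<open>k\<close>. All exponents of \<open>\<wp>'\<close> are admitted, which makes products and
  derivatives of monomials easy; \<open>normal_form\<close> removes the higher ones. The rule \<open>zero\<close> covers weights
  without monomials, such as 1.\<close>
inductive wp_form :: "nat \<Rightarrow> (complex \<Rightarrow> complex \<Rightarrow> complex) \<Rightarrow> bool" where
  zero: "wp_form k (\<lambda>\<tau> z. 0)"
| monomial: "2 * a + 4 * b + 6 * c + 2 * s + 3 * t = k \<Longrightarrow>
    wp_form k (\<lambda>\<tau> z. C * eisenstein_monomial a b c \<tau> * weierstrass_wp z \<tau> ^ s * weierstrass_wp' z \<tau> ^ t)"
| add: "wp_form k F \<Longrightarrow> wp_form k G \<Longrightarrow> wp_form k (\<lambda>\<tau> z. F \<tau> z + G \<tau> z)"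
| cong: "wp_form k F \<Longrightarrow> (\<And>\<tau> z. Im \<tau> > 0 \<Longrightarrow> z \<notin> period_lattice \<tau> \<Longrightarrow> G \<tau> z = F \<tau> z) \<Longrightarrow> wp_form k G"

text \<open>The hypothesis on the weight is conditional because differentiating a monomial also produces terms
  with coefficient 0 whose weight is wrong, as the natural number \<open>0 - 1\<close> is 0.\<close>
lemma wp_form_monomial:
  assumes "C \<noteq> 0 \<Longrightarrow> 2 * a + 4 * b + 6 * c + 2 * s + 3 * t = k"
  shows "wp_form k (\<lambda>\<tau> z. C * eisenstein_monomial a b c \<tau> * weierstrass_wp z \<tau> ^ s * weierstrass_wp' z \<tau> ^ t)"
  using assms by (cases "C = 0") (auto intro: wp_form.zero wp_form.monomial)

lemma wp_form_mult:
  assumes "wp_form j F" "wp_form k G"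
  shows "wp_form (j + k) (\<lambda>\<tau> z. F \<tau> z * G \<tau> z)"
  using assms
proof (induction rule: wp_form.induct)
  case (monomial a b c s t j C)
  from monomial(2,1) show ?case
  proof (induction rule: wp_form.induct)
    case (monomial a' b' c' s' t' k C')
    have "wp_form (j + k) (\<lambda>\<tau> z. C * C' * eisenstein_monomial (a + a') (b + b') (c + c') \<tau> *
        weierstrass_wp z \<tau> ^ (s + s') * weierstrass_wp' z \<tau> ^ (t + t'))"
      using monomial by (intro wp_form.monomial) auto
    then show ?case
      by (simp add: eisenstein_monomial_def power_add mult_ac)
  next
    case (add k F G)
    then show ?case by (simp add: distrib_left wp_form.add)
  next
    case (cong k F G)
    from cong(3)[OF cong(4)] show ?case by (rule wp_form.cong) (simp add: cong)
  qed (simp add: wp_form.zero)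
next
  case (add k F G)
  then show ?case by (simp add: distrib_right wp_form.add)
next
  case (cong k F G)
  from cong(3)[OF cong(4)] show ?case by (rule wp_form.cong) (simp add: cong)
qed (simp add: wp_form.zero)

lemma wp_form_const: "wp_form 0 (\<lambda>\<tau> z. C)"
  using wp_form.monomial[of 0 0 0 0 0 0 C] by (simp add: eisenstein_monomial_def)

lemma wp_form_cmult: "wp_form k F \<Longrightarrow> wp_form k (\<lambda>\<tau> z. C * F \<tau> z)"
  using wp_form_mult[OF wp_form_const] by simp

lemma wp_form_diff: "wp_form k F \<Longrightarrow> wp_form k G \<Longrightarrow> wp_form k (\<lambda>\<tau> z. F \<tau> z - G \<tau> z)"
  using wp_form.add[OF _ wp_form_cmult[of k G "- 1"], of F] by simp

lemma (in lattice) wp_deriv: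
  assumes "z \<notin> L"
  shows "((\<lambda>z. weierstrass_wp z \<tau>) has_field_derivative weierstrass_wp' z \<tau>) (at z)"
    and "((\<lambda>z. weierstrass_wp' z \<tau>) has_field_derivative
           6 * weierstrass_wp z \<tau> ^ 2 - 30 * eisenstein_G 4 \<tau>) (at z)"
proof -
  show "((\<lambda>z. weierstrass_wp z \<tau>) has_field_derivative weierstrass_wp' z \<tau>) (at z)"
    by (rule has_field_derivative_transform_within_open[OF _ open_compl_L, of "wpk 2"])
       (use wpk_deriv[of 2 z] assms in \<open>auto simp: wp_eq wp'_eq eval_nat_numeral\<close>)
  have "((\<lambda>z. - 2 * wpk 3 z) has_field_derivative - 2 * (- of_nat 3 * wpk (Suc 3) z)) (at z)"
    using assms by (intro DERIV_cmult wpk_deriv) auto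
  then have "((\<lambda>z. - 2 * wpk 3 z) has_field_derivative
      6 * weierstrass_wp z \<tau> ^ 2 - 30 * eisenstein_G 4 \<tau>) (at z)"
    using wpk_4_eq[OF assms] by (simp add: wp_eq[OF assms] G4_eq)
  then show "((\<lambda>z. weierstrass_wp' z \<tau>) has_field_derivative
      6 * weierstrass_wp z \<tau> ^ 2 - 30 * eisenstein_G 4 \<tau>) (at z)"
    by (rule has_field_derivative_transform_within_open[OF _ open_compl_L])
       (use assms in \<open>auto simp: wp'_eq\<close>)
qed

lemma (in lattice) wp'_sq:
  assumes "z \<notin> L"
  shows "weierstrass_wp' z \<tau> ^ 2 = 4 * weierstrass_wp z \<tau> ^ 3
    - 60 * eisenstein_G 4 \<tau> * weierstrass_wp z \<tau> - 140 * eisenstein_G 6 \<tau>"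
  using wpk_3_sq[OF assms] assms by (simp add: wp_eq wp'_eq G4_eq G6_eq power_mult_distrib)

text \<open>By the Leibniz rule, as \<open>\<wp>\<close>, \<open>\<wp>'\<close> and \<open>\<wp>'' = 6 \<wp>\<^sup>2 - 30 G\<^sub>4\<close> have weights 2, 3 and 4.\<close>
lemma wp_form_deriv:
  assumes "wp_form k F"
  shows "\<exists>F'. wp_form (Suc k) F' \<and> (\<forall>\<tau> z. Im \<tau> > 0 \<longrightarrow> z \<notin> period_lattice \<tau> \<longrightarrow>
    (F \<tau> has_field_derivative F' \<tau> z) (at z))"
  using assms
proof (induction rule: wp_form.induct)
  case (zero k)
  show ?case by (intro exI[of _ "\<lambda>\<tau> z. 0"]) (simp add: wp_form.zero)
next
  case (monomial a b c s t k C)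
  let ?M = "\<lambda>C a b c s t \<tau> z. C * eisenstein_monomial a b c \<tau> * weierstrass_wp z \<tau> ^ s * weierstrass_wp' z \<tau> ^ t"
  let ?F' = "\<lambda>\<tau> z. ?M (of_nat s * C) a b c (s - 1) (t + 1) \<tau> z +
    (?M (6 * of_nat t * C) a b c (s + 2) (t - 1) \<tau> z + ?M (- 30 * of_nat t * C) a (b + 1) c s (t - 1) \<tau> z)"
  have "wp_form (Suc k) ?F'"
    using monomial by (intro wp_form.add wp_form_monomial) auto
  moreover have "(?M C a b c s t \<tau> has_field_derivative ?F' \<tau> z) (at z)"
    if "Im \<tau> > 0" "z \<notin> period_lattice \<tau>" for \<tau> z
  proof -
    interpret lattice \<tau> by unfold_locales (rule that)
    let ?A = "C * eisenstein_monomial a b c \<tau>"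
    have "((\<lambda>z. ?A * (weierstrass_wp z \<tau> ^ s * weierstrass_wp' z \<tau> ^ t)) has_field_derivative
      ?A * (weierstrass_wp z \<tau> ^ s * (of_nat t * (6 * weierstrass_wp z \<tau> ^ 2 - 30 * eisenstein_G 4 \<tau>) *
          weierstrass_wp' z \<tau> ^ (t - Suc 0)) +
        of_nat s * weierstrass_wp' z \<tau> * weierstrass_wp z \<tau> ^ (s - Suc 0) * weierstrass_wp' z \<tau> ^ t)) (at z)"
      using wp_deriv[OF that(2)]
      by (auto intro!: derivative_eq_intros simp: algebra_simps)
    then show ?thesis
      by (simp add: eisenstein_monomial_def algebra_simps power2_eq_square)
  qed
  ultimately show ?case by blast
next
  case (add k F G)
  then obtain F' G' where "wp_form (Suc k) F'" "wp_form (Suc k) G'"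
    "\<forall>\<tau> z. Im \<tau> > 0 \<longrightarrow> z \<notin> period_lattice \<tau> \<longrightarrow> (F \<tau> has_field_derivative F' \<tau> z) (at z)"
    "\<forall>\<tau> z. Im \<tau> > 0 \<longrightarrow> z \<notin> period_lattice \<tau> \<longrightarrow> (G \<tau> has_field_derivative G' \<tau> z) (at z)"
    by blast
  then show ?case
    by (intro exI[of _ "\<lambda>\<tau> z. F' \<tau> z + G' \<tau> z"]) (auto intro: wp_form.add DERIV_add)
next
  case (cong k F G)
  then obtain F' where F': "wp_form (Suc k) F'"
    "\<And>\<tau> z. Im \<tau> > 0 \<Longrightarrow> z \<notin> period_lattice \<tau> \<Longrightarrow> (F \<tau> has_field_derivative F' \<tau> z) (at z)"
    by blast
  have "(G \<tau> has_field_derivative F' \<tau> z) (at z)" if "Im \<tau> > 0" "z \<notin> period_lattice \<tau>" for \<tau> z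
  proof -
    interpret lattice \<tau> by unfold_locales (rule that)
    show ?thesis
      by (rule has_field_derivative_transform_within_open[OF F'(2) open_compl_L])
         (use that cong in auto)
  qed
  then show ?case using F'(1) by blast
qed

text \<open>Induction on \<open>k\<close>, as the derivative of \<open>\<wp>\<^sub>k\<close> is \<open>- k \<wp>\<^bsub>k+1\<^esub>\<close>.\<close>
lemma wp_form_wpk: "k \<ge> 2 \<Longrightarrow> wp_form k (\<lambda>\<tau> z. lattice.wpk \<tau> k z)"
proof (induction k rule: nat_induct_at_least)
  case base
  have "wp_form 2 (\<lambda>\<tau> z. 1 * eisenstein_monomial 0 0 0 \<tau> * weierstrass_wp z \<tau> ^ 1 * weierstrass_wp' z \<tau> ^ 0)"
    by (rule wp_form.monomial) simp
  then show ?case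
    by (rule wp_form.cong) (simp add: lattice.wp_eq[OF lattice.intro] eisenstein_monomial_def)
next
  case (Suc k)
  obtain F' where F': "wp_form (Suc k) F'"
    "\<And>\<tau> z. Im \<tau> > 0 \<Longrightarrow> z \<notin> period_lattice \<tau> \<Longrightarrow> (lattice.wpk \<tau> k has_field_derivative F' \<tau> z) (at z)"
    using wp_form_deriv[OF Suc.IH] by blast
  have "wp_form (Suc k) (\<lambda>\<tau> z. - 1 / of_nat k * F' \<tau> z)"
    by (rule wp_form_cmult[OF F'(1)])
  then show ?case
  proof (rule wp_form.cong)
    fix \<tau> z assume \<tau>: "Im \<tau> > 0" "z \<notin> period_lattice \<tau>"
    interpret lattice \<tau> by unfold_locales (rule \<tau>)
    have "F' \<tau> z = - of_nat k * wpk (Suc k) z"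
      using DERIV_unique[OF F'(2)[OF \<tau>] wpk_deriv[OF Suc.hyps \<tau>(2)]] .
    then show "wpk (Suc k) z = - 1 / of_nat k * F' \<tau> z" using Suc.hyps by simp
  qed
qed

lemma wp_form_power_sum:
  assumes "k \<ge> 2"
  shows "wp_form k (\<lambda>\<tau> z. lattice.power_sum \<tau> k z)"
proof -
  have "wp_form k (\<lambda>\<tau> z. (if k = 2 then 1 else 0) * eisenstein_monomial 1 0 0 \<tau> * weierstrass_wp z \<tau> ^ 0 * weierstrass_wp' z \<tau> ^ 0)"
    by (rule wp_form_monomial) (simp split: if_splits)
  from wp_form.add[OF wp_form_wpk[OF assms] this] show ?thesis
    by (rule wp_form.cong) (simp add: lattice.power_sum_def[OF lattice.intro] eisenstein_monomial_def)
qed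

lemma wp_form_newton:
  assumes "h \<ge> 2" "i \<ge> 1"
  shows "wp_form (h * (r + i)) (\<lambda>\<tau> z. newton (\<lambda>i. lattice.power_sum \<tau> (h * i) z) r i)"
  using assms(2)
proof (induction r arbitrary: i)
  case 0
  then have "2 * 1 \<le> h * i" using assms(1) by (intro mult_le_mono) auto
  then show ?case by (simp add: wp_form_power_sum)
next
  case (Suc r)
  have "2 * 1 \<le> h * i" using assms(1) Suc.prems by (intro mult_le_mono) auto
  then have "2 \<le> h * i" by simp
  then have "wp_form (h * i + h * (r + 1)) (\<lambda>\<tau> z. lattice.power_sum \<tau> (h * i) z *
      (1 / of_nat (Suc r) * newton (\<lambda>i. lattice.power_sum \<tau> (h * i) z) r 1))"
    by (intro wp_form_mult wp_form_cmult wp_form_power_sum Suc.IH) auto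
  moreover have "wp_form (h * (r + Suc i)) (\<lambda>\<tau> z. newton (\<lambda>i. lattice.power_sum \<tau> (h * i) z) r (Suc i))"
    by (rule Suc.IH) simp
  moreover have "h * i + h * (r + 1) = h * (Suc r + i)" "h * (r + Suc i) = h * (Suc r + i)"
    by (simp_all add: algebra_simps)
  ultimately have "wp_form (h * (Suc r + i)) (\<lambda>\<tau> z. lattice.power_sum \<tau> (h * i) z *
        (1 / of_nat (Suc r) * newton (\<lambda>i. lattice.power_sum \<tau> (h * i) z) r 1))"
    and "wp_form (h * (Suc r + i)) (\<lambda>\<tau> z. newton (\<lambda>i. lattice.power_sum \<tau> (h * i) z) r (Suc i))"
    by (simp_all only:)
  from wp_form_diff[OF this] show ?case
    by (rule wp_form.cong) simp
qed

lemma wp_form_newton_esym: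
  assumes "h \<ge> 2"
  shows "wp_form (h * r) (\<lambda>\<tau> z. newton_esym (\<lambda>i. lattice.power_sum \<tau> (h * i) z) r)"
proof (cases r)
  case 0
  then show ?thesis using wp_form_const[of 1] by (simp add: newton_esym_def)
next
  case (Suc s)
  then show ?thesis
    using wp_form_cmult[OF wp_form_newton[OF assms, of 1 s], of "1 / of_nat (Suc s)"]
    by (simp add: newton_esym_def del: of_nat_Suc)
qed

lemma quasimodular_form_zero: "quasimodular_form k (\<lambda>\<tau>. 0)"
  unfolding quasimodular_form_def by (intro exI[of _ "\<lambda>_ _ _. 0"]) simp

lemma quasimodular_form_add:
  assumes "quasimodular_form k f" "quasimodular_form k g"
  shows "quasimodular_form k (\<lambda>\<tau>. f \<tau> + g \<tau>)"
proof -
  obtain p q where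
    "\<forall>\<tau>. Im \<tau> > 0 \<longrightarrow> f \<tau> = (\<Sum>(a, b, c)\<in>{(a, b, c). 2 * a + 4 * b + 6 * c = k}.
       p a b c * eisenstein_G 2 \<tau> ^ a * eisenstein_G 4 \<tau> ^ b * eisenstein_G 6 \<tau> ^ c)"
    "\<forall>\<tau>. Im \<tau> > 0 \<longrightarrow> g \<tau> = (\<Sum>(a, b, c)\<in>{(a, b, c). 2 * a + 4 * b + 6 * c = k}.
       q a b c * eisenstein_G 2 \<tau> ^ a * eisenstein_G 4 \<tau> ^ b * eisenstein_G 6 \<tau> ^ c)"
    using assms unfolding quasimodular_form_def by blast
  then show ?thesis
    unfolding quasimodular_form_def
    by (intro exI[of _ "\<lambda>a b c. p a b c + q a b c"])
       (simp add: case_prod_unfold sum.distrib[symmetric] algebra_simps)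
qed

lemma quasimodular_form_monomial:
  assumes "2 * a + 4 * b + 6 * c = k"
  shows "quasimodular_form k (\<lambda>\<tau>. C * eisenstein_monomial a b c \<tau>)"
  unfolding quasimodular_form_def
proof (intro exI[of _ "\<lambda>a' b' c'. if (a', b', c') = (a, b, c) then C else 0"] allI impI)
  fix \<tau> :: complex
  have "(\<Sum>(a', b', c')\<in>{(a, b, c). 2 * a + 4 * b + 6 * c = k}.
      (if (a', b', c') = (a, b, c) then C else 0) * eisenstein_G 2 \<tau> ^ a' * eisenstein_G 4 \<tau> ^ b' * eisenstein_G 6 \<tau> ^ c')
    = (\<Sum>x\<in>{(a, b, c). 2 * a + 4 * b + 6 * c = k}. if x = (a, b, c) then C * eisenstein_monomial a b c \<tau> else 0)"
    by (intro sum.cong) (auto simp: eisenstein_monomial_def split: if_splits)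
  also have "\<dots> = C * eisenstein_monomial a b c \<tau>"
    using assms by (simp add: sum.delta finite_weight_exponents)
  finally show "C * eisenstein_monomial a b c \<tau> = (\<Sum>(a', b', c')\<in>{(a, b, c). 2 * a + 4 * b + 6 * c = k}.
      (if (a', b', c') = (a, b, c) then C else 0) * eisenstein_G 2 \<tau> ^ a' * eisenstein_G 4 \<tau> ^ b' * eisenstein_G 6 \<tau> ^ c')" ..
qed

definition normal_form :: "nat \<Rightarrow> (complex \<Rightarrow> complex \<Rightarrow> complex) \<Rightarrow> (nat \<Rightarrow> nat \<Rightarrow> complex \<Rightarrow> complex) \<Rightarrow> bool" where
  "normal_form k F f \<longleftrightarrow>
    (\<forall>s t. t \<in> {0, 1} \<and> 2 * s + 3 * t \<le> k \<longrightarrow> quasimodular_form (k - 2 * s - 3 * t) (f s t)) \<and>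
    (\<forall>\<tau> z. Im \<tau> > 0 \<and> z \<notin> period_lattice \<tau> \<longrightarrow>
       F \<tau> z = (\<Sum>(s, t)\<in>{(s, t). t \<in> {0, 1} \<and> 2 * s + 3 * t \<le> k}.
         f s t \<tau> * weierstrass_wp z \<tau> ^ s * weierstrass_wp' z \<tau> ^ t))"

lemma normal_form_add:
  assumes "normal_form k F f" "normal_form k G g"
  shows "normal_form k (\<lambda>\<tau> z. F \<tau> z + G \<tau> z) (\<lambda>s t \<tau>. f s t \<tau> + g s t \<tau>)"
  using assms unfolding normal_form_def
  by (auto simp: quasimodular_form_add case_prod_unfold sum.distrib[symmetric] algebra_simps)

lemma normal_form_zero: "normal_form k (\<lambda>\<tau> z. 0) (\<lambda>s t \<tau>. 0)"
  by (simp add: normal_form_def quasimodular_form_zero)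

lemma normal_form_cong:
  assumes "normal_form k F f" "\<And>\<tau> z. Im \<tau> > 0 \<Longrightarrow> z \<notin> period_lattice \<tau> \<Longrightarrow> G \<tau> z = F \<tau> z"
  shows "normal_form k G f"
  using assms by (simp add: normal_form_def)

lemma normal_form_reduced_monomial:
  assumes "2 * a + 4 * b + 6 * c + 2 * s + 3 * t = k" "t \<in> {0, 1}"
  shows "\<exists>f. normal_form k (\<lambda>\<tau> z. C * eisenstein_monomial a b c \<tau> * weierstrass_wp z \<tau> ^ s * weierstrass_wp' z \<tau> ^ t) f"
proof
  let ?f = "\<lambda>s' t' \<tau>. if (s', t') = (s, t) then C * eisenstein_monomial a b c \<tau> else 0"
  have qm: "quasimodular_form (k - 2 * s' - 3 * t') (?f s' t')" for s' t'
  proof (cases "(s', t') = (s, t)")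
    case True
    then show ?thesis using assms by (auto intro!: quasimodular_form_monomial)
  next
    case False
    then show ?thesis by (simp only: if_False quasimodular_form_zero)
  qed
  have "(\<Sum>(s', t')\<in>{(s, t). t \<in> {0, 1} \<and> 2 * s + 3 * t \<le> k}. ?f s' t' \<tau> * weierstrass_wp z \<tau> ^ s' * weierstrass_wp' z \<tau> ^ t')
    = (\<Sum>x\<in>{(s, t). t \<in> {0, 1} \<and> 2 * s + 3 * t \<le> k}.
        if x = (s, t) then C * eisenstein_monomial a b c \<tau> * weierstrass_wp z \<tau> ^ s * weierstrass_wp' z \<tau> ^ t else 0)" for \<tau> z
    by (intro sum.cong) (auto split: if_splits)
  also have "\<dots> \<tau> z = C * eisenstein_monomial a b c \<tau> * weierstrass_wp z \<tau> ^ s * weierstrass_wp' z \<tau> ^ t" for \<tau> z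
    using assms finite_wp_exponents[of k] by (subst sum.delta) auto
  finally show "normal_form k (\<lambda>\<tau> z. C * eisenstein_monomial a b c \<tau> * weierstrass_wp z \<tau> ^ s * weierstrass_wp' z \<tau> ^ t) ?f"
    unfolding normal_form_def using qm by simp
qed

text \<open>Each use of the equation for \<open>\<wp>'\<^sup>2\<close> keeps the weight and lowers the exponent of \<open>\<wp>'\<close> by 2.\<close>
lemma normal_form_monomial:
  assumes "2 * a + 4 * b + 6 * c + 2 * s + 3 * t = k"
  shows "\<exists>f. normal_form k (\<lambda>\<tau> z. C * eisenstein_monomial a b c \<tau> * weierstrass_wp z \<tau> ^ s * weierstrass_wp' z \<tau> ^ t) f"
  using assms
proof (induction t arbitrary: a b c s C rule: less_induct)
  case (less t)
  show ?case
  proof (cases "t \<in> {0, 1}")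
    case True
    then show ?thesis using normal_form_reduced_monomial less.prems by blast
  next
    case False
    then obtain u where t: "t = u + 2" by (metis add_2_eq_Suc' insertI1 insertI2 not0_implies_Suc One_nat_def)
    let ?M = "\<lambda>C a b c s t \<tau> z. C * eisenstein_monomial a b c \<tau> * weierstrass_wp z \<tau> ^ s * weierstrass_wp' z \<tau> ^ t"
    obtain f1 f2 f3 where
      "normal_form k (?M (4 * C) a b c (s + 3) u) f1"
      "normal_form k (?M (- 60 * C) a (b + 1) c (s + 1) u) f2"
      "normal_form k (?M (- 140 * C) a b (c + 1) s u) f3"
      using less.IH[of u a b c "s + 3" "4 * C"] less.IH[of u a "b + 1" c "s + 1" "- 60 * C"]
        less.IH[of u a b "c + 1" s "- 140 * C"] less.prems t by auto
    from normal_form_add[OF normal_form_add[OF this(1,2)] this(3)]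
    have "normal_form k (?M C a b c s t) (\<lambda>s t \<tau>. f1 s t \<tau> + f2 s t \<tau> + f3 s t \<tau>)"
    proof (rule normal_form_cong)
      fix \<tau> z assume \<tau>: "Im \<tau> > 0" "z \<notin> period_lattice \<tau>"
      interpret lattice \<tau> by unfold_locales (rule \<tau>)
      have eq: "weierstrass_wp' z \<tau> ^ t = weierstrass_wp' z \<tau> ^ u * (4 * weierstrass_wp z \<tau> ^ 3
        - 60 * eisenstein_G 4 \<tau> * weierstrass_wp z \<tau> - 140 * eisenstein_G 6 \<tau>)"
        unfolding t power_add wp'_sq[OF \<tau>(2)] ..
      show "?M C a b c s t \<tau> z = ?M (4 * C) a b c (s + 3) u \<tau> z + ?M (- 60 * C) a (b + 1) c (s + 1) u \<tau> z
          + ?M (- 140 * C) a b (c + 1) s u \<tau> z"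
        unfolding eq by (simp add: eisenstein_monomial_def power_add algebra_simps)
    qed
    then show ?thesis by blast
  qed
qed

lemma wp_form_normal_form:
  assumes "wp_form k F"
  shows "\<exists>f. normal_form k F f"
  using assms
proof (induction rule: wp_form.induct)
  case (zero k)
  show ?case using normal_form_zero by blast
next
  case (monomial a b c s t k C)
  then show ?case by (rule normal_form_monomial)
next
  case (add k F G)
  then show ?case using normal_form_add by blast
next
  case (cong k F G)
  then obtain f where "normal_form k F f" by blast
  then have "normal_form k G f" by (rule normal_form_cong) (rule cong)
  then show ?case by blast
qed

section \<open>The pole at the origin\<close>

context lattice
begin

lemma eventually_not_in_L: "\<forall>\<^sub>F z in at 0. z \<notin> L"
proof -
  obtain d where d: "d > 0" "\<And>w. w \<in> L - {0} \<Longrightarrow> norm w \<ge> d"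
    using norm_lattice_ge by blast
  then show ?thesis unfolding eventually_at by (intro exI[of _ d]) force
qed

text \<open>Apart from the contribution of \<open>w = 0\<close>, all power sums are regular at the origin. By
  \<open>newton_add_power\<close> with \<open>c = z\<^sup>-\<^sup>h\<close>, adding this contribution to their \<open>e\<^sub>r\<close> only adds \<open>c e\<^bsub>r-1\<^esub>\<close>.\<close>
lemma pole_order_newton_esym:
  assumes "h \<ge> 2" "r \<ge> 1"
  shows "\<exists>l. ((\<lambda>z. z ^ h * newton_esym (\<lambda>i. power_sum (h * i) z) r) \<longlongrightarrow> l) (at 0)"
proof -
  obtain s where r: "r = Suc s" using assms by (cases r) auto
  define q where "q = (\<lambda>z i. regular_part (h * i) z + (if h * i = 2 then eisenstein_G 2 \<tau> else 0))"
  have q: "((\<lambda>z. q z i) \<longlongrightarrow> q 0 i) (at 0)" if "i \<ge> 1" for i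
  proof -
    have "2 * 1 \<le> h * i" using assms(1) that by (intro mult_le_mono) auto
    then show ?thesis
      unfolding q_def by (intro tendsto_intros regular_part_isCont_0) auto
  qed
  have p: "(\<lambda>i. power_sum (h * i) z) = (\<lambda>i. (1 / z ^ h) ^ i + q z i)" for z
    by (simp add: power_sum_def wpk_def q_def power_mult power_divide add.assoc)
  have "((\<lambda>z. z ^ h * newton_esym (q z) r + newton_esym (q z) s) \<longlongrightarrow>
      0 ^ h * newton_esym (q 0) r + newton_esym (q 0) s) (at 0)"
    by (intro tendsto_intros tendsto_newton_esym q)
  then have "((\<lambda>z. z ^ h * newton_esym (\<lambda>i. power_sum (h * i) z) r) \<longlongrightarrow>
      0 ^ h * newton_esym (q 0) r + newton_esym (q 0) s) (at 0)"
  proof (rule tendsto_cong[THEN iffD1, rotated])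
    show "\<forall>\<^sub>F z in at 0. z ^ h * newton_esym (q z) r + newton_esym (q z) s =
        z ^ h * newton_esym (\<lambda>i. power_sum (h * i) z) r"
      by (rule eventually_at_filter[THEN iffD2], rule always_eventually)
         (auto simp: p r newton_add_power(2) distrib_left)
  qed
  then show ?thesis by blast
qed

text \<open>The leading coefficients of \<open>\<wp>\<close> and \<open>\<wp>'\<close> at the origin are 1 and \<open>- 2\<close>.\<close>
lemma pole_order_wp_monomial:
  assumes "2 * s + 3 * t \<le> d"
  shows "((\<lambda>z. z ^ d * (weierstrass_wp z \<tau> ^ s * weierstrass_wp' z \<tau> ^ t)) \<longlongrightarrow>
    (if 2 * s + 3 * t = d then (- 2) ^ t else 0)) (at 0)"
proof -
  let ?k = "d - (2 * s + 3 * t)"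
  have lim: "((\<lambda>z. z ^ ?k * ((1 + z ^ 2 * regular_part 2 z) ^ s * (- 2 * (1 + z ^ 3 * regular_part 3 z)) ^ t)) \<longlongrightarrow>
     0 ^ ?k * ((1 + 0 ^ 2 * regular_part 2 0) ^ s * (- 2 * (1 + 0 ^ 3 * regular_part 3 0)) ^ t)) (at 0)"
    by (intro tendsto_intros regular_part_isCont_0) auto
  have val: "0 ^ ?k * ((1 + 0 ^ 2 * regular_part 2 0) ^ s * (- 2 * (1 + 0 ^ 3 * regular_part 3 0)) ^ t)
     = (if 2 * s + 3 * t = d then (- 2) ^ t else 0)"
    using assms by (simp add: power_0_left)
  have "((\<lambda>z. z ^ ?k * ((1 + z ^ 2 * regular_part 2 z) ^ s * (- 2 * (1 + z ^ 3 * regular_part 3 z)) ^ t)) \<longlongrightarrow>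
     (if 2 * s + 3 * t = d then (- 2) ^ t else 0)) (at 0)"
    using lim unfolding val .
  then show ?thesis
  proof (rule tendsto_cong[THEN iffD1, rotated])
    show "\<forall>\<^sub>F z in at 0. z ^ ?k * ((1 + z ^ 2 * regular_part 2 z) ^ s * (- 2 * (1 + z ^ 3 * regular_part 3 z)) ^ t)
      = z ^ d * (weierstrass_wp z \<tau> ^ s * weierstrass_wp' z \<tau> ^ t)"
      using eventually_not_in_L
    proof eventually_elim
      case (elim z)
      then have z: "z \<noteq> 0" by auto
      have "1 + z ^ 2 * regular_part 2 z = z ^ 2 * weierstrass_wp z \<tau>"
        and "- 2 * (1 + z ^ 3 * regular_part 3 z) = z ^ 3 * weierstrass_wp' z \<tau>"
        using z by (simp_all add: wp_eq[OF elim] wp'_eq[OF elim] wpk_def algebra_simps)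
      moreover have "z ^ d = z ^ (?k + (2 * s + 3 * t))"
        using assms by simp
      then have "z ^ d = z ^ ?k * ((z ^ 2) ^ s * (z ^ 3) ^ t)"
        by (simp only: power_add power_mult)
      ultimately show ?case by (simp add: power_mult_distrib mult_ac)
    qed
  qed
qed

text \<open>For \<open>t \<in> {0, 1}\<close> the number \<open>2 s + 3 t\<close> determines \<open>s\<close> and \<open>t\<close>. So among the terms with nonzero
  coefficient exactly one has the largest pole order \<open>d\<close>, and the sum has a pole of order \<open>d\<close>.\<close>
lemma wp_expansion_pole_order:
  assumes E: "\<And>z. z \<notin> L \<Longrightarrow> E z = (\<Sum>(s, t)\<in>{(s, t). t \<in> {0, 1} \<and> 2 * s + 3 * t \<le> k}.
      c s t * weierstrass_wp z \<tau> ^ s * weierstrass_wp' z \<tau> ^ t)"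
    and lim: "((\<lambda>z. z ^ h * E z) \<longlongrightarrow> l) (at 0)"
    and st: "t \<in> {0, 1}" "2 * s + 3 * t \<le> k" "2 * s + 3 * t > h"
  shows "c s t = 0"
proof (rule ccontr)
  let ?I = "{(s, t). t \<in> {0, 1} \<and> 2 * s + 3 * t \<le> k}"
  let ?w = "\<lambda>(s, t). 2 * s + 3 * t"
  let ?B = "{x \<in> ?I. c (fst x) (snd x) \<noteq> 0}"
  assume "c s t \<noteq> 0"
  then have B: "(s, t) \<in> ?B" using st by auto
  have fin: "finite ?B" using finite_wp_exponents[of k] by simp
  define d where "d = Max (?w ` ?B)"
  have "d \<in> ?w ` ?B" unfolding d_def using B fin by (intro Max_in) auto
  then obtain x where x: "x \<in> ?B" "d = ?w x" by blast
  obtain s0 t0 where "x = (s0, t0)" by (cases x)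
  with x have st0: "(s0, t0) \<in> ?B" "d = 2 * s0 + 3 * t0" by simp_all
  have le_d: "2 * s' + 3 * t' \<le> d" if "(s', t') \<in> ?B" for s' t'
    unfolding d_def using that fin by (intro Max_ge) (auto intro!: image_eqI[of _ _ "(s', t')"])
  have dh: "d > h" using le_d[OF B] st by simp
  have "((\<lambda>z. \<Sum>x\<in>?I. c (fst x) (snd x) * (z ^ d * (weierstrass_wp z \<tau> ^ fst x * weierstrass_wp' z \<tau> ^ snd x)))
      \<longlongrightarrow> (\<Sum>x\<in>?I. if x = (s0, t0) then c s0 t0 * (- 2) ^ t0 else 0)) (at 0)"
  proof (rule tendsto_sum)
    fix x assume x: "x \<in> ?I"
    show "((\<lambda>z. c (fst x) (snd x) * (z ^ d * (weierstrass_wp z \<tau> ^ fst x * weierstrass_wp' z \<tau> ^ snd x)))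
        \<longlongrightarrow> (if x = (s0, t0) then c s0 t0 * (- 2) ^ t0 else 0)) (at 0)"
    proof (cases "x \<in> ?B")
      case False
      then have "c (fst x) (snd x) = 0" "x \<noteq> (s0, t0)" using x st0 by auto
      then show ?thesis by simp
    next
      case True
      obtain s' t' where x': "x = (s', t')" by (cases x)
      have eq: "2 * s' + 3 * t' = d \<longleftrightarrow> x = (s0, t0)"
        using x x' st0 by auto presburger+
      have "2 * s' + 3 * t' \<le> d" using le_d True x' by blast
      then have "((\<lambda>z. c s' t' * (z ^ d * (weierstrass_wp z \<tau> ^ s' * weierstrass_wp' z \<tau> ^ t'))) \<longlongrightarrow>
          c s' t' * (if 2 * s' + 3 * t' = d then (- 2) ^ t' else 0)) (at 0)"
        by (intro tendsto_mult_left pole_order_wp_monomial)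
      moreover have "c s' t' * (if 2 * s' + 3 * t' = d then (- 2) ^ t' else 0)
          = (if x = (s0, t0) then c s0 t0 * (- 2) ^ t0 else 0)"
        unfolding eq using x' by auto
      ultimately show ?thesis by (simp only: x' fst_conv snd_conv)
    qed
  qed
  also have "(\<Sum>x\<in>?I. if x = (s0, t0) then c s0 t0 * (- 2) ^ t0 else 0) = c s0 t0 * (- 2) ^ t0"
    using st0 finite_wp_exponents[of k] by (subst sum.delta) auto
  finally have lim1: "((\<lambda>z. \<Sum>x\<in>?I. c (fst x) (snd x) * (z ^ d * (weierstrass_wp z \<tau> ^ fst x * weierstrass_wp' z \<tau> ^ snd x)))
      \<longlongrightarrow> c s0 t0 * (- 2) ^ t0) (at 0)" .
  have "((\<lambda>z. z ^ (d - h) * (z ^ h * E z)) \<longlongrightarrow> 0 ^ (d - h) * l) (at 0)"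
    by (intro tendsto_intros lim)
  then have lim2: "((\<lambda>z. z ^ (d - h) * (z ^ h * E z)) \<longlongrightarrow> 0) (at 0)"
    using dh by (simp add: power_0_left)
  have "\<forall>\<^sub>F z in at 0. z ^ (d - h) * (z ^ h * E z) =
      (\<Sum>x\<in>?I. c (fst x) (snd x) * (z ^ d * (weierstrass_wp z \<tau> ^ fst x * weierstrass_wp' z \<tau> ^ snd x)))"
    using eventually_not_in_L
  proof eventually_elim
    case (elim z)
    have "z ^ (d - h) * (z ^ h * E z) = z ^ d * E z"
      using dh by (simp flip: mult.assoc power_add)
    also have "\<dots> = (\<Sum>x\<in>?I. c (fst x) (snd x) * (z ^ d * (weierstrass_wp z \<tau> ^ fst x * weierstrass_wp' z \<tau> ^ snd x)))"
      unfolding E[OF elim] sum_distrib_left case_prod_unfold by (intro sum.cong) (auto simp: mult_ac)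
    finally show ?case .
  qed
  from tendsto_cong[OF this] lim2 have "((\<lambda>z. \<Sum>x\<in>?I. c (fst x) (snd x) *
      (z ^ d * (weierstrass_wp z \<tau> ^ fst x * weierstrass_wp' z \<tau> ^ snd x))) \<longlongrightarrow> 0) (at 0)"
    by simp
  then have "c s0 t0 * (- 2) ^ t0 = 0"
    using tendsto_unique[OF at_neq_bot lim1] by blast
  then show False using st0 by simp
qed

lemma multiple_wp_eq:
  assumes "h \<ge> 2" "z \<notin> L"
  shows "multiple_wp (replicate r h) z \<tau> = newton_esym (\<lambda>i. power_sum (h * i) z) r"
proof -
  have "(\<Sum>ws\<in>lattice_chains \<tau> (length (replicate r h)) M N.
       1 / (\<Prod>i<length (replicate r h). (z - ws ! i) ^ (replicate r h ! i)))
    = newton_esym (\<lambda>i. \<Sum>w\<in>lattice_box \<tau> M N. 1 / (z - w) ^ (h * i)) r" for M N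
    using chain_sum_eq_esym[OF Im_pos, where r = r and M = M and N = N and z = z and h = h]
    by (simp add: esym_eq_newton_esym finite_lattice_box power_divide power_mult)
  moreover have "box_limit (\<lambda>M N. newton_esym (\<lambda>i. \<Sum>w\<in>lattice_box \<tau> M N. 1 / (z - w) ^ (h * i)) r)
      (newton_esym (\<lambda>i. power_sum (h * i) z) r)"
  proof (intro box_limit_newton_esym box_limit_power_sum)
    fix i :: nat assume "i \<ge> 1"
    then have "2 * 1 \<le> h * i" using assms(1) by (intro mult_le_mono) auto
    then show "h * i \<ge> 2" by simp
  qed (rule assms)
  ultimately show ?thesis
    unfolding multiple_wp_def by (simp only: lim_lim_eq)
qed

end

theorem proposition3p4:
  fixes h r :: nat
  assumes "h \<ge> 2" and "r \<ge> 1"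
  shows "\<exists>f :: nat \<Rightarrow> nat \<Rightarrow> complex \<Rightarrow> complex.
    (\<forall>s t. t \<in> {0, 1} \<and> 2 * s + 3 * t \<le> h \<longrightarrow>
       quasimodular_form (h * r - 2 * s - 3 * t) (f s t)) \<and>
    (\<forall>\<tau> z. Im \<tau> > 0 \<and> z \<notin> period_lattice \<tau> \<longrightarrow>
       multiple_wp (replicate r h) z \<tau> =
         (\<Sum>(s, t)\<in>{(s, t). t \<in> {0, 1} \<and> 2 * s + 3 * t \<le> h}.
            f s t \<tau> * weierstrass_wp z \<tau> ^ s * weierstrass_wp' z \<tau> ^ t))"
proof -
  obtain f where f: "normal_form (h * r) (\<lambda>\<tau> z. newton_esym (\<lambda>i. lattice.power_sum \<tau> (h * i) z) r) f"
    using wp_form_normal_form[OF wp_form_newton_esym[OF assms(1)]] by blast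
  have "h * 1 \<le> h * r" using assms by (intro mult_le_mono) auto
  then have hr: "h \<le> h * r" by simp
  show ?thesis
  proof (intro exI[of _ f] conjI allI impI)
    fix s t assume "t \<in> {0, 1} \<and> 2 * s + 3 * t \<le> h"
    then have "t \<in> {0, 1} \<and> 2 * s + 3 * t \<le> h * r" using hr order_trans by blast
    then show "quasimodular_form (h * r - 2 * s - 3 * t) (f s t)"
      using f unfolding normal_form_def by blast
  next
    fix \<tau> z assume "Im \<tau> > 0 \<and> z \<notin> period_lattice \<tau>"
    then have \<tau>: "Im \<tau> > 0" "z \<notin> period_lattice \<tau>" by auto
    interpret lattice \<tau> by unfold_locales (rule \<tau>)
    have E: "newton_esym (\<lambda>i. power_sum (h * i) z) r =
        (\<Sum>(s, t)\<in>{(s, t). t \<in> {0, 1} \<and> 2 * s + 3 * t \<le> h * r}.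
          f s t \<tau> * weierstrass_wp z \<tau> ^ s * weierstrass_wp' z \<tau> ^ t)" if "z \<notin> L" for z
      using f \<tau>(1) that by (simp add: normal_form_def)
    obtain l where l: "((\<lambda>z. z ^ h * newton_esym (\<lambda>i. power_sum (h * i) z) r) \<longlongrightarrow> l) (at 0)"
      using pole_order_newton_esym[OF assms] by blast
    have vanish: "f s t \<tau> = 0" if "t \<in> {0, 1}" "2 * s + 3 * t \<le> h * r" "2 * s + 3 * t > h" for s t
      by (rule wp_expansion_pole_order[where k = "h * r" and c = "\<lambda>s t. f s t \<tau>", OF E l that])
    let ?I = "\<lambda>k. {(s, t). t \<in> {0, 1} \<and> 2 * s + 3 * t \<le> k}"
    let ?term = "\<lambda>(s, t). f s t \<tau> * weierstrass_wp z \<tau> ^ s * weierstrass_wp' z \<tau> ^ t"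
    have "sum ?term (?I (h * r)) = sum ?term (?I h)"
    proof (rule sum.mono_neutral_right[OF finite_wp_exponents])
      show "?I h \<subseteq> ?I (h * r)" using order_trans[OF _ hr] by blast
      show "\<forall>x \<in> ?I (h * r) - ?I h. ?term x = 0"
      proof
        fix x assume x: "x \<in> ?I (h * r) - ?I h"
        obtain s t where st: "x = (s, t)" by (cases x)
        have "f s t \<tau> = 0" using x by (intro vanish) (auto simp: st not_le)
        then show "?term x = 0" by (simp add: st)
      qed
    qed
    then show "multiple_wp (replicate r h) z \<tau> = sum ?term (?I h)"
      unfolding multiple_wp_eq[OF assms(1) \<tau>(2)] E[OF \<tau>(2)] .
  qed
qed

end
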